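(* Let $\Gamma$ be a signed graph of order $n$ such that each connected component of $\Gamma$ has at least two vertices. Then $$i_-(\Gamma)=\frac{n-p(\Gamma)}{2}-\theta(\Gamma)$$ if and only if $\Gamma$ is a disjoint union of signed cycles $C_{n_1}^\sigma\cup C_{n_2}^\sigma\cup\cdots\cup C_{n_t}^\sigma$, where $n_1+n_2+\cdots+n_t=n$ and, for each $i\in\{1,2,\ldots,t\}$, $n_i\equiv 0\pmod 4$ if $C_{n_i}^\sigma$ is balanced and $n_i\equiv 2\pmod 4$ if $C_{n_i}^\sigma$ is unbalanced.
   Context: All graphs are finite and simple. A signed graph $\Gamma=(G,\sigma)$ consists of a simple graph $G=(V(G),E(G))$ (the underlying graph) and a sign function $\sigma:E(G)\to\{+,-\}$. Its order is $n=|V(G)|$. Graph-theoretic notions for $\Gamma$ (connectedness, degree, cycles, components) refer to $G$. The adjacency matrix $A(\Gamma)$ is the real symmetric matrix indexed by $V(G)$ whose $(u,v)$ entry is $+1$ if $uv\in E(G)$ and $\sigma(uv)=+$, $-1$ if $uv\in E(G)$ and $\sigma(uv)=-$, and $0$ if $uv\notin E(G)$. The negative inertia index $i_-(\Gamma)$ is the number of negative eigenvalues of $A(\Gamma)$, counted with multiplicity. The cyclomatic number is $\theta(\Gamma)=|E(G)|-|V(G)|+c(G)$, where $c(G)$ is the number of connected components of $G$. A pendant vertex is a vertex of degree $1$, and $p(\Gamma)$ denotes the number of pendant vertices of $\Gamma$. $C_m^\sigma$ denotes a signed graph whose underlying graph is the cycle with $m$ vertices ($m\ge 3$). The sign of a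 signed cycle is the product of the signs of its edges; the signed cycle $C_m^\sigma$ is balanced if its sign is $+$ and unbalanced if its sign is $-$. *)

theory Defs
  imports Jordan_Normal_Form.Char_Poly "HOL-Library.Disjoint_Sets"
begin

text \<open>The signs \<open>+\<close> and \<open>-\<close> are the real numbers \<open>1\<close> and \<open>-1\<close>; the sign function
  is unconstrained outside the edge set.\<close>

record 'a sgraph =
  verts :: "'a set"
  edges :: "'a set set"
  esign :: "'a set \<Rightarrow> real"

locale signed_graph =
  fixes \<Gamma> :: "'a sgraph"
  assumes finite_verts: "finite (verts \<Gamma>)"
    and edges_simple: "e \<in> edges \<Gamma> \<Longrightarrow> e \<subseteq> verts \<Gamma> \<and> card e = 2"
    and esign_values: "e \<in> edges \<Gamma> \<Longrightarrow> esign \<Gamma> e \<in> {1, -1}"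

definition graph_order :: "'a sgraph \<Rightarrow> nat" where
  "graph_order \<Gamma> = card (verts \<Gamma>)"

definition degree :: "'a sgraph \<Rightarrow> 'a \<Rightarrow> nat" where
  "degree \<Gamma> v = card {e \<in> edges \<Gamma>. v \<in> e}"

definition num_pendant :: "'a sgraph \<Rightarrow> nat" where
  "num_pendant \<Gamma> = card {v \<in> verts \<Gamma>. degree \<Gamma> v = 1}"

definition connected_rel :: "'a sgraph \<Rightarrow> ('a \<times> 'a) set" where
  "connected_rel \<Gamma> =
     {(u, v). u \<in> verts \<Gamma> \<and> v \<in> verts \<Gamma> \<and> (u, v) \<in> {(x, y). {x, y} \<in> edges \<Gamma>}\<^sup>*}"

definition components :: "'a sgraph \<Rightarrow> 'a set set" where
  "components \<Gamma> = verts \<Gamma> // connected_rel \<Gamma>"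

definition cyclomatic_number :: "'a sgraph \<Rightarrow> int" where
  "cyclomatic_number \<Gamma> =
     int (card (edges \<Gamma>)) - int (card (verts \<Gamma>)) + int (card (components \<Gamma>))"

definition adj_entry :: "'a sgraph \<Rightarrow> 'a \<Rightarrow> 'a \<Rightarrow> real" where
  "adj_entry \<Gamma> u v = (if {u, v} \<in> edges \<Gamma> then esign \<Gamma> {u, v} else 0)"

text \<open>Library matrices are indexed by natural numbers, so the vertices are enumerated in an
  arbitrary order; another order conjugates the matrix by a permutation matrix and hence does not
  affect its spectrum.\<close>

definition vertex_list :: "'a sgraph \<Rightarrow> 'a list" where
  "vertex_list \<Gamma> = (SOME vs. distinct vs \<and> set vs = verts \<Gamma>)"

lemma vertex_list:
  assumes "finite (verts \<Gamma>)"
  shows "distinct (vertex_list \<Gamma>)" "set (vertex_list \<Gamma>) = verts \<Gamma>"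
proof -
  have "\<exists>vs. distinct vs \<and> set vs = verts \<Gamma>"
    using finite_distinct_list[OF assms] by blast
  then have "distinct (vertex_list \<Gamma>) \<and> set (vertex_list \<Gamma>) = verts \<Gamma>"
    unfolding vertex_list_def by (rule someI_ex)
  then show "distinct (vertex_list \<Gamma>)" "set (vertex_list \<Gamma>) = verts \<Gamma>" by auto
qed

definition adj_mat :: "'a sgraph \<Rightarrow> real mat" where
  "adj_mat \<Gamma> = mat (graph_order \<Gamma>) (graph_order \<Gamma>)
     (\<lambda>(i, j). adj_entry \<Gamma> (vertex_list \<Gamma> ! i) (vertex_list \<Gamma> ! j))"

definition neg_inertia :: "'a sgraph \<Rightarrow> nat" where
  "neg_inertia \<Gamma> =
     (\<Sum>x \<in> {x. eigenvalue (adj_mat \<Gamma>) x \<and> x < 0}. order x (char_poly (adj_mat \<Gamma>)))"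

definition is_signed_cycle :: "nat \<Rightarrow> 'a sgraph \<Rightarrow> bool" where
  "is_signed_cycle m C \<longleftrightarrow> signed_graph C \<and> m \<ge> 3 \<and>
     (\<exists>vs. length vs = m \<and> distinct vs \<and> verts C = set vs \<and>
           edges C = {{vs ! i, vs ! (Suc i mod m)} | i. i < m})"

definition cycle_sign :: "'a sgraph \<Rightarrow> real" where
  "cycle_sign C = (\<Prod>e \<in> edges C. esign C e)"

definition balanced_cycle :: "'a sgraph \<Rightarrow> bool" where
  "balanced_cycle C \<longleftrightarrow> cycle_sign C = 1"

definition unbalanced_cycle :: "'a sgraph \<Rightarrow> bool" where
  "unbalanced_cycle C \<longleftrightarrow> cycle_sign C = -1"

definition is_disjoint_union :: "'a sgraph \<Rightarrow> nat \<Rightarrow> (nat \<Rightarrow> 'a sgraph) \<Rightarrow> bool" where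
  "is_disjoint_union \<Gamma> t C \<longleftrightarrow>
     disjoint_family_on (\<lambda>i. verts (C i)) {..<t} \<and>
     verts \<Gamma> = (\<Union>i<t. verts (C i)) \<and>
     edges \<Gamma> = (\<Union>i<t. edges (C i)) \<and>
     (\<forall>i<t. \<forall>e \<in> edges (C i). esign \<Gamma> e = esign (C i) e)"

end

theory Submission
  imports Defs Jordan_Normal_Form.Schur_Decomposition
begin

text \<open>
  Write \<open>w 0 = 0\<close>, \<open>w 1 = 1\<close> and \<open>w d = 3 - d\<close> for \<open>d \<ge> 2\<close>. For a graph with \<open>n\<close> vertices, \<open>m\<close>
  edges, \<open>p\<close> pendant and no isolated vertices, the degree weights \<open>w\<close> add up to \<open>3n - 2m - p\<close>,
  so with \<open>c\<close> components twice the right-hand side of the claim is the total weight minus \<open>2c\<close>.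
  By Sylvester's law the negative inertia index is the largest dimension of a negative definite
  subspace. A connected graph on at least two vertices carries a negative definite subspace of
  dimension \<open>k\<close> with \<open>2k\<close> at least its weight minus \<open>1\<close>, unless it is one of the cycles in the
  theorem, where \<open>1\<close> must be replaced by \<open>2\<close>. The induction deletes a pendant edge, or else a
  vertex that lies on a cycle next to a vertex of degree at least \<open>3\<close>; such a vertex is the end of
  a longest path. The remaining graphs are cycles. An even cycle is bipartite, with form
  \<open>2 y\<^sup>T B z\<close>, and \<open>B\<close> is invertible exactly if the sign of the cycle is not \<open>(-1)\<close> to half its
  length. Conversely, for the cycles in the theorem one vertex class together with the kernel of
  \<open>B\<close> spans an isotropic subspace, which bounds the inertia index from above.
\<close>

section \<open>Inertia of real symmetric matrices\<close>

text \<open>The arithmetic behind the induction: when a vertex of degree d \<ge> 2 is deleted, each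
  of the at most d components of the rest is charged 1, and the weight 3 - d of the vertex turns
  this into a total charge of 3. A cycle through the vertex puts two of its neighbours into one
  component, which saves 1. If one of these two has degree at least 3, its weight rises with the
  deletion and that component is free, which saves another 1. So the target charge 1 needs a vertex
  on a cycle next to a branching vertex. A pendant edge also starts from charge 3, but the
  hyperbolic plane of the edge contributes one dimension, worth 2. On a bare cycle no neighbour has
  degree 3, deletion stops at charge 2, and the missing 1 must come from parity (odd length) or from
  the invertible form (even length). The exceptional cycles reappear as components during the
  induction, so their larger defect has to be carried in the induction hypothesis. In the converse
  direction an isotropic subspace of dimension h + 1 on such a cycle of length 2h leaves room for at
  most h - 1 negative eigenvalues.\<close>

lemma real_symmetric_eigenvalue:
  fixes A :: "real mat"
  assumes A: "A \<in> carrier_mat n n" and sym: "transpose_mat A = A" and n: "n > 0"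
  shows "\<exists>x. eigenvalue A x"
proof -
  let ?C = "map_mat complex_of_real A"
  have C: "?C \<in> carrier_mat n n" using A by simp
  have "Polynomial.degree (char_poly ?C) = n" using degree_monic_char_poly[OF C] by simp
  with n have "\<not> constant (poly (char_poly ?C))" by (simp add: constant_degree)
  then obtain z where z: "poly (char_poly ?C) z = 0"
    using fundamental_theorem_of_algebra by blast
  then have "eigenvalue ?C z" using eigenvalue_root_char_poly[OF C] by simp
  then obtain v where v: "v \<in> carrier_vec n" "v \<noteq> 0\<^sub>v n" "?C *\<^sub>v v = z \<cdot>\<^sub>v v"
    unfolding eigenvalue_def eigenvector_def using A by auto
  define a where "a i = Re (v $ i)" for i
  define b where "b i = Im (v $ i)" for i
  have ev: "(\<Sum>j<n. of_real (A $$ (i,j)) * v $ j) = z * v $ i" if "i < n" for i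
  proof -
    have "(?C *\<^sub>v v) $ i = (\<Sum>j<n. of_real (A $$ (i,j)) * v $ j)"
      using that A v(1) by (auto simp: scalar_prod_def atLeast0LessThan intro!: sum.cong)
    then show ?thesis using v(1,3) that by simp
  qed
  have ra: "(\<Sum>j<n. A $$ (i,j) * a j) = Re z * a i - Im z * b i" if "i < n" for i
    using arg_cong[OF ev[OF that], of Re] by (simp add: a_def b_def)
  have rb: "(\<Sum>j<n. A $$ (i,j) * b j) = Re z * b i + Im z * a i" if "i < n" for i
    using arg_cong[OF ev[OF that], of Im] by (simp add: a_def b_def)
  have symA: "A $$ (i,j) = A $$ (j,i)" if "i < n" "j < n" for i j
    using sym A that by (metis carrier_matD index_transpose_mat(1))
  \<comment> \<open>Symmetry equates the pairing of b with Aa and that of a with Ab. After inserting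
    \<open>ra\<close> and \<open>rb\<close> the terms with Re z cancel, and what remains is Im z
    times the squared norm of v.\<close>
  have "(\<Sum>i<n. b i * (\<Sum>j<n. A $$ (i,j) * a j)) = (\<Sum>i<n. \<Sum>j<n. A $$ (i,j) * a j * b i)"
    by (simp add: sum_distrib_left mult_ac)
  also have "\<dots> = (\<Sum>j<n. \<Sum>i<n. A $$ (i,j) * a j * b i)" by (rule sum.swap)
  also have "\<dots> = (\<Sum>j<n. a j * (\<Sum>i<n. A $$ (j,i) * b i))"
    by (auto simp: sum_distrib_left mult_ac symA intro!: sum.cong)
  finally have "(\<Sum>i<n. b i * (Re z * a i - Im z * b i)) = (\<Sum>i<n. a i * (Re z * b i + Im z * a i))"
    using ra rb by simp
  then have "(\<Sum>i<n. a i * (Re z * b i + Im z * a i) - b i * (Re z * a i - Im z * b i)) = 0"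
    by (simp add: sum_subtractf)
  moreover have "a i * (Re z * b i + Im z * a i) - b i * (Re z * a i - Im z * b i)
      = Im z * (a i ^ 2 + b i ^ 2)" for i
    by (simp add: algebra_simps power2_eq_square)
  ultimately have "(\<Sum>i<n. Im z * (a i ^ 2 + b i ^ 2)) = 0" by simp
  then have im: "Im z * (\<Sum>i<n. a i ^ 2 + b i ^ 2) = 0"
    by (simp only: sum_distrib_left)
  have "(\<Sum>i<n. a i ^ 2 + b i ^ 2) \<noteq> 0"
  proof
    assume "(\<Sum>i<n. a i ^ 2 + b i ^ 2) = 0"
    then have "\<forall>i<n. a i ^ 2 + b i ^ 2 = 0"
      by (subst (asm) sum_nonneg_eq_0_iff) auto
    then have "v = 0\<^sub>v n" using v(1)
      by (intro eq_vecI) (auto simp: a_def b_def complex_eq_iff sum_power2_eq_zero_iff)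
    with v(2) show False ..
  qed
  with im have "Im z = 0" by simp
  then have z': "z = of_real (Re z)" by (simp add: complex_eq_iff)
  have "char_poly ?C = map_poly of_real (char_poly A)"
    by (rule of_real_hom.char_poly_hom[OF A])
  with z z' have "poly (map_poly complex_of_real (char_poly A)) (of_real (Re z)) = 0" by metis
  then have "poly (char_poly A) (Re z) = 0" by simp
  then show ?thesis using eigenvalue_root_char_poly[OF A] by auto
qed

text \<open>Gram-Schmidt keeps the head of the completed basis, which is \<open>v\<close>; the
  normalisation afterwards only rescales it, whence the factor \<open>c\<close>.\<close>

lemma orthogonal_extension:
  fixes v :: "real vec"
  assumes v: "v \<in> carrier_vec n" and v0: "v \<noteq> 0\<^sub>v n"
  obtains W c where "W \<in> carrier_mat n n" "transpose_mat W * W = 1\<^sub>m n" "col W 0 = c \<cdot>\<^sub>v v"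
proof -
  interpret cof_vec_space n "TYPE(real)" .
  define b where "b = basis_completion v"
  define ws where "ws = gram_schmidt n b"
  from basis_completion[OF v v0, folded b_def]
  have dist_b: "distinct b" and indep: "\<not> lin_dep (set b)" and b: "set b \<subseteq> carrier_vec n"
    and hdb: "hd b = v" and len_b: "length b = n" by auto
  have n: "n > 0" using v v0 by (cases n) auto
  from hdb len_b n obtain vs where bv: "b = v # vs" by (cases b) auto
  from gram_schmidt_result[OF b dist_b indep refl, folded ws_def]
  have ws: "set ws \<subseteq> carrier_vec n" "corthogonal ws" "length ws = n"
    by (auto simp: len_b)
  have hdws: "hd ws = v" using gram_schmidt_hd[OF v, of vs, folded bv] unfolding ws_def .
  define us where "us = map (\<lambda>w. (1 / sqrt (w \<bullet> w)) \<cdot>\<^sub>v w) ws"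
  define W where "W = mat_of_cols n us"
  have us: "set us \<subseteq> carrier_vec n" "length us = n" using ws by (auto simp: us_def)
  have W: "W \<in> carrier_mat n n" using us unfolding W_def by auto
  have colW: "col W i = us ! i" if "i < n" for i
    using that us unfolding W_def by (simp add: col_mat_of_cols subset_iff)
  have wsi: "ws ! i \<in> carrier_vec n" if "i < n" for i using that ws by auto
  have orth: "ws ! i \<bullet> ws ! j = 0 \<longleftrightarrow> i \<noteq> j" if "i < n" "j < n" for i j
    using corthogonalD[OF ws(2), of i j] that ws by (simp add: conjugate_vec_def)
  have usi: "us ! i = (1 / sqrt (ws ! i \<bullet> ws ! i)) \<cdot>\<^sub>v ws ! i" if "i < n" for i
    using that ws by (simp add: us_def)
  have prod: "us ! i \<bullet> us ! j = (if i = j then 1 else 0)" if "i < n" "j < n" for i j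
  proof -
    have "us ! i \<bullet> us ! j = (1 / sqrt (ws ! i \<bullet> ws ! i)) * (1 / sqrt (ws ! j \<bullet> ws ! j)) * (ws ! i \<bullet> ws ! j)"
      using that wsi[OF that(1)] wsi[OF that(2)] by (simp add: usi)
    moreover have "ws ! i \<bullet> ws ! i > 0"
      using orth[OF that(1) that(1)] by (simp add: less_le scalar_prod_def sum_nonneg)
    ultimately show ?thesis using orth[OF that] by (cases "i = j") simp_all
  qed
  have WW: "transpose_mat W * W = 1\<^sub>m n"
    using W by (intro eq_matI) (auto simp: colW prod)
  have "col W 0 = (1 / sqrt (v \<bullet> v)) \<cdot>\<^sub>v v"
    using colW[OF n] usi[OF n] hdws ws(3) n by (cases ws) auto
  with that[OF W WW] show ?thesis by blast
qed

text \<open>Deflation: in an orthonormal basis that starts with an eigenvector the first column of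
  the matrix is already diagonal, by symmetry so is the first row, and the induction hypothesis
  handles the remaining block.\<close>

theorem real_symmetric_diagonalization:
  fixes A :: "real mat"
  assumes "A \<in> carrier_mat n n" "transpose_mat A = A"
  shows "\<exists>P\<in>carrier_mat n n. transpose_mat P * P = 1\<^sub>m n \<and> diagonal_mat (transpose_mat P * A * P)"
  using assms
proof (induction n arbitrary: A)
  case 0
  then show ?case by (intro bexI[of _ "1\<^sub>m 0"]) (auto simp: diagonal_mat_def)
next
  case (Suc n A)
  note A = Suc.prems(1) and sym = Suc.prems(2)
  obtain e where "eigenvalue A e" using real_symmetric_eigenvalue[OF A sym] by auto
  then obtain v where v: "v \<in> carrier_vec (Suc n)" "v \<noteq> 0\<^sub>v (Suc n)" "A *\<^sub>v v = e \<cdot>\<^sub>v v"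
    unfolding eigenvalue_def eigenvector_def using A by auto
  obtain W c where W: "W \<in> carrier_mat (Suc n) (Suc n)" and WW: "transpose_mat W * W = 1\<^sub>m (Suc n)"
    and colW: "col W 0 = c \<cdot>\<^sub>v v" using orthogonal_extension[OF v(1,2)] by metis
  define A' where "A' = transpose_mat W * A * W"
  have A': "A' \<in> carrier_mat (Suc n) (Suc n)" using A W by (simp add: A'_def)
  have symA': "transpose_mat A' = A'"
  proof -
    have "transpose_mat A' = transpose_mat W * (transpose_mat A * transpose_mat (transpose_mat W))"
      unfolding A'_def using A W
      by (subst transpose_mult[of _ "Suc n" "Suc n" _ "Suc n"]) (auto simp: transpose_mult[of _ "Suc n" "Suc n"])
    then show ?thesis using A W sym by (simp add: A'_def assoc_mult_mat[of _ _ "Suc n"])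
  qed
  have A'0: "A' $$ (i, 0) = (if i = 0 then e else 0)" if "i < Suc n" for i
  proof -
    have AW: "col (A * W) 0 = e \<cdot>\<^sub>v col W 0"
    proof -
      have "col (A * W) 0 = A *\<^sub>v (c \<cdot>\<^sub>v v)" unfolding colW[symmetric] by (rule col_mult2[OF A W]) simp
      also have "\<dots> = c \<cdot>\<^sub>v (A *\<^sub>v v)" using A v by (intro mult_mat_vec)
      also have "\<dots> = e \<cdot>\<^sub>v col W 0" by (simp only: v colW smult_smult_assoc mult.commute)
      finally show ?thesis .
    qed
    have "A' = transpose_mat W * (A * W)" unfolding A'_def using A W by (simp add: assoc_mult_mat[of _ _ "Suc n"])
    then have "A' $$ (i, 0) = col W i \<bullet> col (A * W) 0" using that A W by simp
    also have "\<dots> = e * (col W i \<bullet> col W 0)" unfolding AW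
      using W that by (simp add: scalar_prod_smult_distrib[of _ "Suc n"])
    also have "col W i \<bullet> col W 0 = (transpose_mat W * W) $$ (i, 0)" using that W by simp
    finally show ?thesis unfolding WW using that by simp
  qed
  have A'0': "A' $$ (0, i) = (if i = 0 then e else 0)" if "i < Suc n" for i
    using A'0[OF that] symA' A' that by (metis carrier_matD index_transpose_mat(1) zero_less_Suc)
  define E where "E = mat 1 1 (\<lambda>_. e)"
  define A3 where "A3 = mat n n (\<lambda>(i,j). A' $$ (Suc i, Suc j))"
  have E: "E \<in> carrier_mat 1 1" and A3: "A3 \<in> carrier_mat n n" by (auto simp: E_def A3_def)
  have block: "A' = four_block_mat E (0\<^sub>m 1 n) (0\<^sub>m n 1) A3"
    using A' A'0 A'0' by (intro eq_matI) (auto simp: E_def A3_def four_block_mat_def)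
  have "transpose_mat A3 = A3"
  proof (rule eq_matI)
    fix i j assume "i < dim_row A3" "j < dim_col A3"
    then have ij: "i < n" "j < n" using A3 by auto
    have "A' $$ (Suc j, Suc i) = transpose_mat A' $$ (Suc i, Suc j)" using ij A' by simp
    also have "\<dots> = A' $$ (Suc i, Suc j)" by (simp only: symA')
    finally show "transpose_mat A3 $$ (i, j) = A3 $$ (i, j)" using ij by (simp add: A3_def)
  qed (use A3 in auto)
  from Suc.IH[OF A3 this] obtain P where P: "P \<in> carrier_mat n n" "transpose_mat P * P = 1\<^sub>m n"
    and dP: "diagonal_mat (transpose_mat P * A3 * P)" by blast
  define R where "R = four_block_mat (1\<^sub>m 1) (0\<^sub>m 1 n) (0\<^sub>m n 1) P"
  have R: "R \<in> carrier_mat (Suc n) (Suc n)" using P four_block_carrier_mat[of "1\<^sub>m 1" 1 1 P n n] unfolding R_def by simp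
  have RT: "transpose_mat R = four_block_mat (1\<^sub>m 1) (0\<^sub>m 1 n) (0\<^sub>m n 1) (transpose_mat P)"
    unfolding R_def using P
    by (subst transpose_four_block_mat[of _ 1 1 _ n _ n]) auto
  have RR: "transpose_mat R * R = 1\<^sub>m (Suc n)"
    unfolding RT unfolding R_def using P
    by (subst mult_four_block_mat[of _ 1 1 _ n _ n _ _ 1 _ n]) (auto simp flip: four_block_one_mat[of 1 n, simplified])
  have "transpose_mat R * A' = four_block_mat E (0\<^sub>m 1 n) (0\<^sub>m n 1) (transpose_mat P * A3)"
    unfolding RT block using P E A3
    by (subst mult_four_block_mat[of _ 1 1 _ n _ n _ _ 1 _ n]) auto
  then have RA: "transpose_mat R * A' * R = four_block_mat E (0\<^sub>m 1 n) (0\<^sub>m n 1) (transpose_mat P * A3 * P)"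
    unfolding R_def using P E A3
    by (simp, subst mult_four_block_mat[of _ 1 1 _ n _ n _ _ 1 _ n]) auto
  have diag: "diagonal_mat (transpose_mat R * A' * R)"
    unfolding RA using dP P E A3 by (auto simp: diagonal_mat_def four_block_mat_def)
  have WR: "W * R \<in> carrier_mat (Suc n) (Suc n)" using W R by simp
  have T: "transpose_mat (W * R) = transpose_mat R * transpose_mat W" by (rule transpose_mult[OF W R])
  note assoc = assoc_mult_mat[of _ "Suc n" "Suc n" _ "Suc n" _ "Suc n"]
  have "transpose_mat (W * R) * (W * R) = transpose_mat R * ((transpose_mat W * W) * R)"
    unfolding T using W R by (simp add: assoc)
  then have "transpose_mat (W * R) * (W * R) = 1\<^sub>m (Suc n)" using R by (simp add: WW RR)
  moreover have "transpose_mat (W * R) * A * (W * R) = transpose_mat R * A' * R"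
    unfolding T A'_def using W R A by (simp add: assoc)
  ultimately show ?case using diag WR by auto
qed

section \<open>Elimination and Sylvester's law of inertia\<close>

lemma homogeneous_system_nontrivial:
  fixes M :: "'e \<Rightarrow> 'u \<Rightarrow> real"
  assumes "finite E" "finite U" "card E < card U"
  shows "\<exists>c. (\<exists>u\<in>U. c u \<noteq> 0) \<and> (\<forall>e\<in>E. (\<Sum>u\<in>U. c u * M e u) = 0)"
  using assms
proof (induction E arbitrary: U M rule: finite_induct)
  case empty
  then have "U \<noteq> {}" by auto
  then obtain u where "u \<in> U" by blast
  then show ?case by (intro exI[of _ "\<lambda>_. 1"]) auto
next
  case (insert e E)
  show ?case
  proof (cases "\<forall>u\<in>U. M e u = 0")
    case True
    from insert.IH[of U M] insert.prems insert.hyps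
    obtain c where "\<exists>u\<in>U. c u \<noteq> 0" "\<forall>e\<in>E. (\<Sum>u\<in>U. c u * M e u) = 0" by auto
    with True show ?thesis by (intro exI[of _ c]) auto
  next
    case False
    \<comment> \<open>Gaussian elimination with pivot \<open>w\<close> in equation \<open>e\<close>:
      \<open>M'\<close> is the reduced system on the other unknowns, and the value of
      \<open>d\<close> at \<open>w\<close> is the one that solves equation \<open>e\<close>.\<close>
    then obtain w where w: "w \<in> U" "M e w \<noteq> 0" by auto
    define U' where "U' = U - {w}"
    define M' where "M' f u = M f u - M f w * M e u / M e w" for f u
    have fU': "finite U'" and cU': "card E < card U'"
      using insert w by (auto simp: U'_def)
    from insert.IH[OF fU' cU', of M'] obtain c where
      c: "\<exists>u\<in>U'. c u \<noteq> 0" "\<And>f. f \<in> E \<Longrightarrow> (\<Sum>u\<in>U'. c u * M' f u) = 0" by auto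
    define s where "s = (\<Sum>u\<in>U'. c u * M e u)"
    define d where "d = c(w := - s / M e w)"
    have split: "(\<Sum>u\<in>U. d u * M f u) = - s / M e w * M f w + (\<Sum>u\<in>U'. c u * M f u)" for f
    proof -
      have "(\<Sum>u\<in>U. d u * M f u) = d w * M f w + (\<Sum>u\<in>U'. d u * M f u)"
        using w insert.prems unfolding U'_def by (simp add: sum.remove)
      also have "(\<Sum>u\<in>U'. d u * M f u) = (\<Sum>u\<in>U'. c u * M f u)"
        by (intro sum.cong) (auto simp: d_def U'_def)
      finally show ?thesis by (simp add: d_def)
    qed
    have "(\<Sum>u\<in>U. d u * M f u) = 0" if "f \<in> insert e E" for f
    proof (cases "f = e")
      case True
      then show ?thesis using w by (simp add: split s_def)
    next
      case False
      with that have "f \<in> E" by simp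
      have "(\<Sum>u\<in>U'. c u * M' f u) = (\<Sum>u\<in>U'. c u * M f u) - (\<Sum>u\<in>U'. M f w / M e w * (c u * M e u))"
        unfolding sum_subtractf[symmetric] by (intro sum.cong) (auto simp: M'_def field_simps)
      also have "(\<Sum>u\<in>U'. M f w / M e w * (c u * M e u)) = M f w / M e w * s"
        by (simp only: sum_distrib_left[symmetric] s_def)
      finally show ?thesis using c(2)[OF \<open>f \<in> E\<close>] by (simp add: split)
    qed
    moreover have "\<exists>u\<in>U. d u \<noteq> 0" using c(1) by (auto simp: d_def U'_def)
    ultimately show ?thesis by blast
  qed
qed

lemma order_prod_linear_factors:
  "Polynomial.order x (\<Prod>a\<leftarrow>as. [:- a, 1:]) = count_list as (x :: real)"
proof (induction as)
  case (Cons a as)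
  have "(\<Prod>a\<leftarrow>as. [:- a, 1:]) \<noteq> 0" by (auto simp: prod_list_zero_iff)
  then have ne: "[:- a, 1:] * (\<Prod>a\<leftarrow>as. [:- a, 1:]) \<noteq> 0" by (subst mult_eq_0_iff) simp
  have "Polynomial.order x (\<Prod>a\<leftarrow>a # as. [:- a, 1:]) = Polynomial.order x [:- a, 1:] + Polynomial.order x (\<Prod>a\<leftarrow>as. [:- a, 1:])"
    by (simp only: list.map prod_list.Cons order_mult[OF ne])
  moreover have "Polynomial.order x [:- a, 1:] = (if a = x then 1 else 0)"
    using order_linear_power'[of x a 1] by (auto simp: order_0I)
  ultimately show ?case using Cons.IH by simp
qed simp

lemma sum_count_list_filter:
  assumes "finite S"
  shows "(\<Sum>x\<in>S. count_list as x) = length (filter (\<lambda>x. x \<in> S) as)"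
proof (induction as)
  case (Cons a as)
  have "(\<Sum>x\<in>S. count_list (a # as) x) = (\<Sum>x\<in>S. count_list as x + (if a = x then 1 else 0))"
    by (intro sum.cong) auto
  then show ?case using Cons.IH assms by (simp add: sum.distrib)
qed simp

definition neg_eigenvalue_count :: "real mat \<Rightarrow> nat" where
  "neg_eigenvalue_count A = (\<Sum>x \<in> {x. eigenvalue A x \<and> x < 0}. Polynomial.order x (char_poly A))"

text \<open>Vectors are plain functions, read only below \<open>n\<close>, so that families of
  functions on vertices can be inserted without carrier conditions.\<close>

definition quad :: "nat \<Rightarrow> real mat \<Rightarrow> (nat \<Rightarrow> real) \<Rightarrow> real" where
  "quad n A x = (\<Sum>i<n. \<Sum>j<n. A $$ (i,j) * x i * x j)"

text \<open>Here \<open>d\<close> lists the eigenvalues and \<open>p k\<close> is the k-th member of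
  an orthonormal eigenbasis. The last property is the expansion in that basis: a vector all of whose
  coordinates vanish is zero below \<open>n\<close>.\<close>

lemma real_symmetric_inertia:
  fixes A :: "real mat"
  assumes A: "A \<in> carrier_mat n n" and sym: "transpose_mat A = A"
  obtains d p where "neg_eigenvalue_count A = card {i. i < n \<and> d i < 0}"
    "\<And>x. quad n A x = (\<Sum>k<n. d k * (\<Sum>i<n. x i * p k i)\<^sup>2)"
    "\<And>x i. i < n \<Longrightarrow> x i = (\<Sum>k<n. p k i * (\<Sum>j<n. x j * p k j))"
proof -
  obtain P where P: "P \<in> carrier_mat n n" and PP: "transpose_mat P * P = 1\<^sub>m n"
    and diag: "diagonal_mat (transpose_mat P * A * P)"
    using real_symmetric_diagonalization[OF A sym] by blast
  define D where "D = transpose_mat P * A * P"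
  have D: "D \<in> carrier_mat n n" using P A by (simp add: D_def)
  have PP': "P * transpose_mat P = 1\<^sub>m n"
    using mat_mult_left_right_inverse[OF _ P PP] P by simp
  note assoc = assoc_mult_mat[of _ n n _ n _ n]
  have AD: "A = P * D * transpose_mat P"
  proof -
    have "P * D * transpose_mat P = (P * transpose_mat P) * A * (P * transpose_mat P)"
      unfolding D_def using P A by (simp add: assoc)
    then show ?thesis using A by (simp add: PP')
  qed
  have "similar_mat_wit A D P (transpose_mat P)"
    by (rule similar_mat_witI[of _ _ n]) (use P D A PP PP' AD in auto)
  then have "char_poly A = char_poly D"
    by (intro char_poly_similar) (auto simp: similar_mat_def)
  moreover have "upper_triangular D" using diag D by (auto simp: diagonal_mat_def D_def)
  ultimately have cp: "char_poly A = (\<Prod>a\<leftarrow>diag_mat D. [:- a, 1:])"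
    using char_poly_upper_triangular[OF D] by simp
  define d where "d i = D $$ (i,i)" for i
  have dm: "diag_mat D = map d [0..<n]" using D by (auto simp: diag_mat_def d_def)
  have ev: "eigenvalue A x \<longleftrightarrow> x \<in> set (diag_mat D)" for x
    unfolding eigenvalue_root_char_poly[OF A] cp by (auto simp: poly_prod_list prod_list_zero_iff)
  have "neg_eigenvalue_count A = length (filter (\<lambda>x. x \<in> {x. x \<in> set (diag_mat D) \<and> x < 0}) (diag_mat D))"
    unfolding neg_eigenvalue_count_def ev cp order_prod_linear_factors
    by (rule sum_count_list_filter) simp
  also have "filter (\<lambda>x. x \<in> {x. x \<in> set (diag_mat D) \<and> x < 0}) (diag_mat D) = filter (\<lambda>x. x < 0) (diag_mat D)"
    by (rule filter_cong) auto
  also have "length \<dots> = length (filter (\<lambda>i. d i < 0) [0..<n])" unfolding dm by (simp add: filter_map o_def)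
  also have "\<dots> = card {i. i < n \<and> d i < 0}"
    by (subst distinct_card[symmetric]) (auto intro!: arg_cong[of _ _ card])
  finally have 1: "neg_eigenvalue_count A = card {i. i < n \<and> d i < 0}" .
  have offdiag: "D $$ (k, l) = (if k = l then d k else 0)" if "k < n" "l < n" for k l
    using diag that D unfolding D_def[symmetric] by (auto simp: diagonal_mat_def d_def)
  have Aij: "A $$ (i, j) = (\<Sum>k<n. d k * P $$ (i,k) * P $$ (j,k))" if "i < n" "j < n" for i j
  proof -
    obtain M where M: "M = P * D" "M \<in> carrier_mat n n" using P D by auto
    have "A $$ (i, j) = (M * transpose_mat P) $$ (i, j)" using AD M by simp
    also have "\<dots> = (\<Sum>l<n. M $$ (i, l) * P $$ (j, l))"
      using that P M(2) by (simp add: scalar_prod_def atLeast0LessThan)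
    also have "\<dots> = (\<Sum>l<n. (P * D) $$ (i, l) * P $$ (j, l))" by (simp add: M(1))
    also have "\<dots> = (\<Sum>l<n. d l * P $$ (i,l) * P $$ (j,l))"
    proof (rule sum.cong[OF refl])
      fix l assume "l \<in> {..<n}"
      then have "(P * D) $$ (i, l) = (\<Sum>k<n. P $$ (i, k) * (if k = l then d k else 0))"
        using that P D by (auto simp: scalar_prod_def atLeast0LessThan offdiag intro!: sum.cong)
      also have "\<dots> = (\<Sum>k<n. if k = l then P $$ (i, k) * d k else 0)" by (intro sum.cong) auto
      also have "\<dots> = P $$ (i, l) * d l" using \<open>l \<in> _\<close> by simp
      finally show "(P * D) $$ (i, l) * P $$ (j, l) = d l * P $$ (i,l) * P $$ (j,l)" by simp
    qed
    finally show ?thesis .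
  qed
  have 2: "quad n A x = (\<Sum>k<n. d k * (\<Sum>i<n. x i * P $$ (i,k))\<^sup>2)" for x
  proof -
    have "quad n A x = (\<Sum>i<n. \<Sum>j<n. \<Sum>k<n. d k * (x i * P $$ (i,k)) * (x j * P $$ (j,k)))"
      unfolding quad_def by (intro sum.cong refl) (simp add: Aij sum_distrib_right sum_distrib_left mult_ac)
    also have "\<dots> = (\<Sum>i<n. \<Sum>k<n. \<Sum>j<n. d k * (x i * P $$ (i,k)) * (x j * P $$ (j,k)))"
      by (intro sum.cong refl sum.swap)
    also have "\<dots> = (\<Sum>k<n. \<Sum>i<n. \<Sum>j<n. d k * (x i * P $$ (i,k)) * (x j * P $$ (j,k)))"
      by (rule sum.swap)
    also have "\<dots> = (\<Sum>k<n. d k * (\<Sum>i<n. x i * P $$ (i,k))\<^sup>2)"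
      by (intro sum.cong refl) (simp add: power2_eq_square sum_product sum_distrib_left mult_ac)
    finally show ?thesis .
  qed
  have 3: "x i = (\<Sum>k<n. P $$ (i,k) * (\<Sum>j<n. x j * P $$ (j,k)))" if "i < n" for x i
  proof -
    have PPij: "(\<Sum>k<n. P $$ (i,k) * P $$ (j,k)) = (if i = j then 1 else 0)" if "j < n" for j
    proof -
      have "(\<Sum>k<n. P $$ (i,k) * P $$ (j,k)) = (P * transpose_mat P) $$ (i, j)"
        using that \<open>i < n\<close> P by (simp add: scalar_prod_def atLeast0LessThan)
      then show ?thesis unfolding PP' using that \<open>i < n\<close> by simp
    qed
    have "(\<Sum>k<n. P $$ (i,k) * (\<Sum>j<n. x j * P $$ (j,k))) = (\<Sum>k<n. \<Sum>j<n. x j * (P $$ (i,k) * P $$ (j,k)))"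
      by (simp add: sum_distrib_left mult_ac)
    also have "\<dots> = (\<Sum>j<n. \<Sum>k<n. x j * (P $$ (i,k) * P $$ (j,k)))" by (rule sum.swap)
    also have "\<dots> = (\<Sum>j<n. x j * (if i = j then 1 else 0))"
      by (simp only: sum_distrib_left[symmetric]) (auto simp: PPij intro!: sum.cong)
    also have "\<dots> = (\<Sum>j<n. if i = j then x j else 0)" by (intro sum.cong) auto
    also have "\<dots> = x i" using that by simp
    finally show ?thesis by simp
  qed
  show thesis by (rule that[of d "\<lambda>k i. P $$ (i,k)"]) (fact 1 2 3)+
qed

text \<open>If \<open>k\<close> were larger, \<open>homogeneous_system_nontrivial\<close> would give
  a nontrivial combination orthogonal to all eigenvectors with negative eigenvalue, where the form
  is nonnegative.\<close>

lemma neg_definite_family_le: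
  fixes A :: "real mat"
  assumes A: "A \<in> carrier_mat n n" "transpose_mat A = A"
    and neg: "\<And>c. \<exists>l<k. c l \<noteq> 0 \<Longrightarrow> quad n A (\<lambda>i. \<Sum>l<k. c l * F l i) < 0"
  shows "k \<le> neg_eigenvalue_count A"
proof (rule ccontr)
  assume less: "\<not> k \<le> neg_eigenvalue_count A"
  obtain d p where
    cnt: "neg_eigenvalue_count A = card {i. i < n \<and> d i < 0}"
    and q: "\<And>x. quad n A x = (\<Sum>k<n. d k * (\<Sum>i<n. x i * p k i)\<^sup>2)"
    by (rule real_symmetric_inertia[OF A]) (rule that)
  have "\<exists>c. (\<exists>u\<in>{..<k}. c u \<noteq> 0) \<and>
      (\<forall>e\<in>{i. i < n \<and> d i < 0}. (\<Sum>u<k. c u * (\<Sum>i<n. F u i * p e i)) = 0)"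
    by (intro homogeneous_system_nontrivial) (use less cnt in auto)
  then obtain c where c: "\<exists>u\<in>{..<k}. c u \<noteq> 0"
    "\<forall>e\<in>{i. i < n \<and> d i < 0}. (\<Sum>u<k. c u * (\<Sum>i<n. F u i * p e i)) = 0"
    by (elim exE conjE) (rule that)
  have comb: "(\<Sum>i<n. (\<Sum>l<k. c l * F l i) * p e i) = (\<Sum>u<k. c u * (\<Sum>i<n. F u i * p e i))" for e
    by (simp only: sum_distrib_right sum_distrib_left mult.assoc) (rule sum.swap)
  have "quad n A (\<lambda>i. \<Sum>l<k. c l * F l i) \<ge> 0"
    unfolding q comb
  proof (rule sum_nonneg)
    fix e assume "e \<in> {..<n}"
    then show "0 \<le> d e * (\<Sum>u<k. c u * (\<Sum>i<n. F u i * p e i))\<^sup>2"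
      using c(2) by (cases "d e < 0") auto
  qed
  with neg[of c] c(1) show False by auto
qed

text \<open>The dual count: on a combination orthogonal to all eigenvectors with nonnegative
  eigenvalue the form is at most 0, hence equal to 0, so every coordinate vanishes and with it the
  vector. A nonnegative value does not rule out the zero vector, which is why independence is a
  hypothesis of its own.\<close>

lemma nonneg_family_le:
  fixes A :: "real mat"
  assumes A: "A \<in> carrier_mat n n" "transpose_mat A = A"
    and indep: "\<And>c. \<exists>l<k. c l \<noteq> 0 \<Longrightarrow> \<exists>i<n. (\<Sum>l<k. c l * F l i) \<noteq> 0"
    and nonneg: "\<And>c. quad n A (\<lambda>i. \<Sum>l<k. c l * F l i) \<ge> 0"
  shows "neg_eigenvalue_count A + k \<le> n"
proof (rule ccontr)
  assume less: "\<not> neg_eigenvalue_count A + k \<le> n"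
  obtain d p where
    cnt: "neg_eigenvalue_count A = card {i. i < n \<and> d i < 0}"
    and q: "\<And>x. quad n A x = (\<Sum>k<n. d k * (\<Sum>i<n. x i * p k i)\<^sup>2)"
    and inv: "\<And>x i. i < n \<Longrightarrow> x i = (\<Sum>k<n. p k i * (\<Sum>j<n. x j * p k j))"
    by (rule real_symmetric_inertia[OF A]) (rule that)
  have "{..<n} = {i. i < n \<and> d i < 0} \<union> {i. i < n \<and> \<not> d i < 0}" by auto
  then have "card {..<n} = card {i. i < n \<and> d i < 0} + card {i. i < n \<and> \<not> d i < 0}"
    by (metis (no_types, lifting) card_Un_disjoint disjoint_iff finite_Un finite_lessThan mem_Collect_eq)
  with less cnt have "card {i. i < n \<and> \<not> d i < 0} < card {..<k}" by simp
  then have "\<exists>c. (\<exists>u\<in>{..<k}. c u \<noteq> 0) \<and>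
      (\<forall>e\<in>{i. i < n \<and> \<not> d i < 0}. (\<Sum>u<k. c u * (\<Sum>i<n. F u i * p e i)) = 0)"
    by (intro homogeneous_system_nontrivial) auto
  then obtain c where c: "\<exists>u\<in>{..<k}. c u \<noteq> 0"
    "\<forall>e\<in>{i. i < n \<and> \<not> d i < 0}. (\<Sum>u<k. c u * (\<Sum>i<n. F u i * p e i)) = 0"
    by (elim exE conjE) (rule that)
  define x where "x i = (\<Sum>l<k. c l * F l i)" for i
  define y where "y e = (\<Sum>i<n. x i * p e i)" for e
  have y: "y e = (\<Sum>u<k. c u * (\<Sum>i<n. F u i * p e i))" for e
    by (simp only: y_def x_def sum_distrib_right sum_distrib_left mult.assoc) (rule sum.swap)
  have "(\<Sum>e<n. d e * (y e)\<^sup>2) \<ge> 0" using nonneg[of c] unfolding q y_def x_def .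
  moreover have le: "d e * (y e)\<^sup>2 \<le> 0" if "e < n" for e
    using that c(2) by (cases "d e < 0") (auto simp: y mult_nonpos_nonneg)
  moreover have "(\<Sum>e<n. d e * (y e)\<^sup>2) \<le> 0" using le by (intro sum_nonpos) auto
  ultimately have "(\<Sum>e<n. - (d e * (y e)\<^sup>2)) = 0" by (simp add: sum_negf)
  then have "\<forall>e<n. d e * (y e)\<^sup>2 = 0"
    using le by (subst (asm) sum_nonneg_eq_0_iff) auto
  then have "y e = 0" if "e < n" for e
    using that c(2) y[of e] by (cases "d e < 0") auto
  then have "x i = 0" if "i < n" for i
    using inv[OF that, of x] by (simp flip: y_def)
  with indep[of c] c(1) show False by (auto simp: x_def)
qed

section \<open>Definite families of vectors on a signed graph\<close>

text \<open>Subgraphs are vertex subsets under one fixed weight function \<open>a\<close>, so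
  deleting vertices just shrinks a set. The condition \<open>vals\<close> makes every nonzero weight
  a sign.\<close>

locale signed_weights =
  fixes V :: "'a set" and a :: "'a \<Rightarrow> 'a \<Rightarrow> real"
  assumes finV: "finite V"
    and sym: "a u v = a v u"
    and irrefl [simp]: "a v v = 0"
    and vals: "a u v \<noteq> 0 \<Longrightarrow> a u v * a u v = 1"
begin

definition act :: "('a \<Rightarrow> real) \<Rightarrow> 'a \<Rightarrow> real" where
  "act f u = (\<Sum>v\<in>V. a u v * f v)"

definition bil :: "('a \<Rightarrow> real) \<Rightarrow> ('a \<Rightarrow> real) \<Rightarrow> real" where
  "bil f g = (\<Sum>u\<in>V. f u * act g u)"

definition neg :: "('a \<Rightarrow> real) \<Rightarrow> bool" where
  "neg f \<longleftrightarrow> bil f f < 0"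

definition nonneg :: "('a \<Rightarrow> real) \<Rightarrow> bool" where
  "nonneg f \<longleftrightarrow> bil f f \<ge> 0 \<and> (\<exists>v\<in>V. f v \<noteq> 0)"

text \<open>The vectors \<open>F 0, \<dots>, F (k - 1)\<close> span a subspace of dimension \<open>k\<close>, since neither
  predicate used for \<open>R\<close> holds of the zero vector.\<close>

definition fam :: "(('a \<Rightarrow> real) \<Rightarrow> bool) \<Rightarrow> 'a set \<Rightarrow> nat \<Rightarrow> bool" where
  "fam R S k \<longleftrightarrow> (\<exists>F :: nat \<Rightarrow> 'a \<Rightarrow> real. (\<forall>i<k. \<forall>v. v \<notin> S \<longrightarrow> F i v = 0) \<and>
     (\<forall>c. (\<exists>i<k. c i \<noteq> 0) \<longrightarrow> R (\<lambda>v. \<Sum>i<k. c i * F i v)))"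

lemma act_add: "act (\<lambda>v. f v + g v) u = act f u + act g u"
  by (simp add: act_def distrib_left sum.distrib)

lemma act_scale: "act (\<lambda>v. c * f v) u = c * act f u"
  by (simp add: act_def sum_distrib_left mult_ac)

lemma act_point: "w \<in> V \<Longrightarrow> act (\<lambda>v. if v = w then x else 0) u = a u w * x"
  using finV by (simp add: act_def if_distrib[of "\<lambda>t. _ * t"] cong: if_cong)

lemma bil_sym: "bil f g = bil g f"
proof -
  have "bil f g = (\<Sum>u\<in>V. \<Sum>v\<in>V. a u v * f u * g v)"
    by (simp add: bil_def act_def sum_distrib_left mult_ac)
  also have "\<dots> = (\<Sum>v\<in>V. \<Sum>u\<in>V. a u v * f u * g v)" by (rule sum.swap)
  also have "\<dots> = bil g f"
    by (simp add: bil_def act_def sum_distrib_left mult_ac sym)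
  finally show ?thesis .
qed

lemma bil_add_left: "bil (\<lambda>v. f v + g v) h = bil f h + bil g h"
  by (simp add: bil_def distrib_right sum.distrib)

lemma bil_add_right: "bil h (\<lambda>v. f v + g v) = bil h f + bil h g"
  by (simp add: bil_def act_add distrib_left sum.distrib)

lemma bil_scale_left: "bil (\<lambda>v. c * f v) h = c * bil f h"
  by (simp add: bil_def sum_distrib_left mult_ac)

lemma bil_scale_right: "bil h (\<lambda>v. c * f v) = c * bil h f"
  by (simp add: bil_def act_scale sum_distrib_left mult_ac)

lemma bil_square_add: "bil (\<lambda>v. f v + g v) (\<lambda>v. f v + g v) = bil f f + 2 * bil f g + bil g g"
  by (simp add: bil_add_left bil_add_right bil_sym[of g f])

lemma bil_point: "w \<in> V \<Longrightarrow> bil (\<lambda>v. if v = w then x else 0) f = x * act f w"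
  using finV by (simp add: bil_def if_distrib[of "\<lambda>t. t * _"] cong: if_cong)

text \<open>Without loops a point vector is isotropic, so only the mixed term survives.\<close>

lemma bil_square_add_point:
  assumes "w \<in> V"
  shows "bil (\<lambda>v. f v + (if v = w then x else 0)) (\<lambda>v. f v + (if v = w then x else 0))
    = bil f f + 2 * x * act f w"
proof -
  let ?e = "\<lambda>v. if v = w then x else 0"
  have "bil f ?e = x * act f w" using bil_sym[of f ?e] bil_point[OF assms] by simp
  moreover have "bil ?e ?e = 0" using assms by (simp add: bil_point act_point)
  ultimately show ?thesis by (simp add: bil_square_add)
qed

lemma bil_eq_0:
  assumes "\<And>u v. f u \<noteq> 0 \<Longrightarrow> g v \<noteq> 0 \<Longrightarrow> a u v = 0"
  shows "bil f g = 0"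
proof -
  have "f u * act g u = 0" for u
  proof (cases "f u = 0")
    case False
    then have "a u v * g v = 0" for v using assms by (cases "g v = 0") auto
    then have "act g u = 0" unfolding act_def by (intro sum.neutral ballI)
    then show ?thesis by simp
  qed simp
  then show ?thesis unfolding bil_def by (intro sum.neutral ballI)
qed

text \<open>Families arise indexed by vertex sets or by disjoint sums; their renumbering by naturals
  happens here once and for all.\<close>

lemma famI:
  assumes I: "finite I" and supp: "\<And>i v. i \<in> I \<Longrightarrow> v \<notin> S \<Longrightarrow> F i v = 0"
    and R: "\<And>c. \<exists>i\<in>I. c i \<noteq> 0 \<Longrightarrow> R (\<lambda>v. \<Sum>i\<in>I. c i * F i v)"
  shows "fam R S (card I)"
proof -
  obtain h where h: "bij_betw h {..<card I} I"
    using ex_bij_betw_nat_finite[OF I] by (auto simp: atLeast0LessThan)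
  define g where "g = the_inv_into {..<card I} h"
  have gh: "g (h i) = i" if "i < card I" for i
    using the_inv_into_f_f[of h "{..<card I}" i] h that by (auto simp: g_def bij_betw_def)
  have hI: "h i \<in> I" if "i < card I" for i using h that by (auto simp: bij_betw_def)
  show ?thesis unfolding fam_def
  proof (intro exI[of _ "\<lambda>i. F (h i)"] conjI allI impI)
    fix c :: "nat \<Rightarrow> real" assume "\<exists>i<card I. c i \<noteq> 0"
    then obtain i where "i < card I" "c i \<noteq> 0" by blast
    then have "\<exists>i\<in>I. (c \<circ> g) i \<noteq> 0" using gh hI by (intro bexI[of _ "h i"]) auto
    from R[OF this] have "R (\<lambda>v. \<Sum>i\<in>I. c (g i) * F i v)" by simp
    also have "(\<lambda>v. \<Sum>i\<in>I. c (g i) * F i v) = (\<lambda>v. \<Sum>i<card I. c i * F (h i) v)"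
    proof
      fix v
      have "(\<Sum>i\<in>I. c (g i) * F i v) = (\<Sum>i<card I. c (g (h i)) * F (h i) v)"
        by (rule sum.reindex_bij_betw[OF h, symmetric])
      then show "(\<Sum>i\<in>I. c (g i) * F i v) = (\<Sum>i<card I. c i * F (h i) v)"
        by (simp add: gh)
    qed
    finally show "R (\<lambda>v. \<Sum>i<card I. c i * F (h i) v)" .
  qed (use supp hI in auto)
qed

lemma fam_0: "fam R S 0"
  by (auto simp: fam_def)

lemma fam_mono:
  assumes "fam R S k" "S \<subseteq> T"
  shows "fam R T k"
proof -
  obtain F where F: "\<forall>i<k. \<forall>v. v \<notin> S \<longrightarrow> F i v = 0"
    "\<forall>c. (\<exists>i<k. c i \<noteq> 0) \<longrightarrow> R (\<lambda>v. \<Sum>i<k. c i * F i v)"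
    using assms(1) unfolding fam_def by (elim exE conjE) (rule that)
  have "\<forall>i<k. \<forall>v. v \<notin> T \<longrightarrow> F i v = 0" using F(1) assms(2) by blast
  with F(2) show ?thesis unfolding fam_def by (intro exI[of _ F] conjI)
qed

definition separated :: "'a set \<Rightarrow> 'a set \<Rightarrow> bool" where
  "separated S T \<longleftrightarrow> S \<inter> T = {} \<and> (\<forall>u\<in>S. \<forall>v\<in>T. a u v = 0)"

text \<open>A nontrivial combination of the joint family can be trivial on one side, so
  \<open>add\<close> has to admit the zero vector as one of the summands.\<close>

lemma fam_Un:
  assumes S: "fam R S k" and T: "fam R T l"
    and add: "\<And>f g. \<lbrakk>\<And>v. v \<notin> S \<Longrightarrow> f v = 0; \<And>v. v \<notin> T \<Longrightarrow> g v = 0;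
      R f \<or> f = (\<lambda>_. 0); R g \<or> g = (\<lambda>_. 0); R f \<or> R g\<rbrakk> \<Longrightarrow> R (\<lambda>v. f v + g v)"
  shows "fam R (S \<union> T) (k + l)"
proof -
  obtain F where F: "\<And>i v. i < k \<Longrightarrow> v \<notin> S \<Longrightarrow> F i v = 0"
    "\<And>c. \<exists>i<k. c i \<noteq> 0 \<Longrightarrow> R (\<lambda>v. \<Sum>i<k. c i * F i v)"
    using S unfolding fam_def by metis
  obtain G where G: "\<And>i v. i < l \<Longrightarrow> v \<notin> T \<Longrightarrow> G i v = 0"
    "\<And>c. \<exists>i<l. c i \<noteq> 0 \<Longrightarrow> R (\<lambda>v. \<Sum>i<l. c i * G i v)"
    using T unfolding fam_def by metis
  have "fam R (S \<union> T) (card ({..<k} <+> {..<l}))"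
  proof (rule famI[where F = "case_sum F G"])
    fix c :: "nat + nat \<Rightarrow> real" assume c: "\<exists>i\<in>{..<k} <+> {..<l}. c i \<noteq> 0"
    define f where "f v = (\<Sum>i<k. c (Inl i) * F i v)" for v
    define g where "g v = (\<Sum>i<l. c (Inr i) * G i v)" for v
    have f: "R f \<or> f = (\<lambda>_. 0) \<and> (\<forall>i<k. c (Inl i) = 0)"
      using F(2)[of "c \<circ> Inl"] by (cases "\<exists>i<k. c (Inl i) \<noteq> 0") (auto simp: f_def[abs_def])
    have g: "R g \<or> g = (\<lambda>_. 0) \<and> (\<forall>i<l. c (Inr i) = 0)"
      using G(2)[of "c \<circ> Inr"] by (cases "\<exists>i<l. c (Inr i) \<noteq> 0") (auto simp: g_def[abs_def])
    have "R (\<lambda>v. f v + g v)"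
    proof (rule add)
      show "R f \<or> R g" using c f g by auto
      show "v \<notin> S \<Longrightarrow> f v = 0" "v \<notin> T \<Longrightarrow> g v = 0" for v
        using F(1) G(1) by (auto simp: f_def g_def)
    qed (use f g in blast)+
    then show "R (\<lambda>v. \<Sum>i\<in>{..<k} <+> {..<l}. c i * case_sum F G i v)"
      by (simp add: sum.Plus f_def g_def)
  qed (use F(1) G(1) in auto)
  then show ?thesis by (simp add: card_Plus)
qed

lemma fam_neg_Un:
  assumes "fam neg S k" "fam neg T l" "separated S T"
  shows "fam neg (S \<union> T) (k + l)"
proof (rule fam_Un[OF assms(1,2)])
  fix f g assume fg: "\<And>v. v \<notin> S \<Longrightarrow> f v = 0" "\<And>v. v \<notin> T \<Longrightarrow> g v = 0"
    "neg f \<or> f = (\<lambda>_. 0)" "neg g \<or> g = (\<lambda>_. 0)" "neg f \<or> neg g"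
  have z: "bil (\<lambda>_. 0) (\<lambda>_. 0) = 0" by (simp add: bil_def)
  have "bil f g = 0" using assms(3) fg(1,2) by (intro bil_eq_0) (metis separated_def)
  then show "neg (\<lambda>v. f v + g v)" using fg(3-5) z by (auto simp: neg_def bil_square_add)
qed

lemma fam_nonneg_Un:
  assumes "fam nonneg S k" "fam nonneg T l" "separated S T"
  shows "fam nonneg (S \<union> T) (k + l)"
proof (rule fam_Un[OF assms(1,2)])
  fix f g assume fg: "\<And>v. v \<notin> S \<Longrightarrow> f v = 0" "\<And>v. v \<notin> T \<Longrightarrow> g v = 0"
    "nonneg f \<or> f = (\<lambda>_. 0)" "nonneg g \<or> g = (\<lambda>_. 0)" "nonneg f \<or> nonneg g"
  have z: "bil (\<lambda>_. 0) (\<lambda>_. 0) = 0" by (simp add: bil_def)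
  have "bil f g = 0" using assms(3) fg(1,2) by (intro bil_eq_0) (metis separated_def)
  then have "bil (\<lambda>v. f v + g v) (\<lambda>v. f v + g v) \<ge> 0"
    using fg(3-5) z by (auto simp: nonneg_def bil_square_add)
  moreover have "\<exists>v\<in>V. f v + g v \<noteq> 0"
  proof -
    obtain v where v: "v \<in> V" "f v \<noteq> 0 \<or> g v \<noteq> 0" using fg(5) by (auto simp: nonneg_def)
    have "f v = 0 \<or> g v = 0" using fg(1,2) assms(3) by (auto simp: separated_def)
    with v show ?thesis by (intro bexI[of _ v]) auto
  qed
  ultimately show "nonneg (\<lambda>v. f v + g v)" by (simp add: nonneg_def)
qed

lemma separated_UN:
  assumes "\<And>L. L \<in> \<K> \<Longrightarrow> separated K L"
  shows "separated K (\<Union>\<K>)"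
  using assms unfolding separated_def by blast

text \<open>The binary step is a parameter, so that negative and nonnegative families share one
  induction.\<close>

lemma fam_Union:
  assumes Un: "\<And>S T k l. fam R S k \<Longrightarrow> fam R T l \<Longrightarrow> separated S T \<Longrightarrow> fam R (S \<union> T) (k + l)"
    and "finite \<K>" "\<And>K. K \<in> \<K> \<Longrightarrow> fam R K (k K)" "pairwise separated \<K>"
  shows "fam R (\<Union>\<K>) (\<Sum>K\<in>\<K>. k K)"
  using assms(2-)
proof (induction \<K> rule: finite_induct)
  case empty
  then show ?case by (simp add: fam_0)
next
  case (insert K \<K>)
  have "separated K (\<Union>\<K>)"
    using insert.prems(2) insert.hyps by (intro separated_UN) (auto simp: pairwise_insert)
  then show ?case using insert by (auto simp: pairwise_insert intro: Un)
qed

lemmas fam_neg_Union = fam_Union[of neg, OF fam_neg_Un]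
lemmas fam_nonneg_Union = fam_Union[of nonneg, OF fam_nonneg_Un]

text \<open>The family on \<open>T\<close> is made orthogonal to \<open>v\<close> by adding multiples of the pendant vertex \<open>u\<close>;
  the new vector spans the hyperbolic plane of the edge \<open>uv\<close>.\<close>

lemma fam_neg_pendant:
  assumes T: "fam neg T k" and u: "u \<in> V" "u \<notin> T" and v: "v \<in> V" "v \<notin> T" and uv: "a u v \<noteq> 0"
    and uT: "\<And>w. w \<in> T \<Longrightarrow> a u w = 0"
  shows "fam neg (insert u (insert v T)) (Suc k)"
proof -
  obtain F where F: "\<And>i v. i < k \<Longrightarrow> v \<notin> T \<Longrightarrow> F i v = 0"
    "\<And>c. \<exists>i<k. c i \<noteq> 0 \<Longrightarrow> neg (\<lambda>v. \<Sum>i<k. c i * F i v)"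
    using T unfolding fam_def by metis
  have ne: "u \<noteq> v" using uv by auto
  \<comment> \<open>Since \<open>a u v\<close> squares to 1, the entry
    \<open>- a u v * act (F i) v\<close> at \<open>u\<close> cancels the row of \<open>v\<close>.
    For the same reason the last vector has value -2, which produces the term
    \<open>- 2 * (c k)\<^sup>2\<close> below.\<close>
  define G where "G i w = (if i < k then F i w + (if w = u then - a u v * act (F i) v else 0)
    else (if w = u then - a u v else 0) + (if w = v then 1 else 0))" for i w
  show ?thesis unfolding fam_def
  proof (intro exI[of _ G] conjI allI impI)
    fix c :: "nat \<Rightarrow> real" assume c: "\<exists>i<Suc k. c i \<noteq> 0"
    define f where "f w = (\<Sum>i<k. c i * F i w)" for w
    define x where "x = - a u v * act f v - a u v * c k"
    have actf: "act f v = (\<Sum>i<k. c i * act (F i) v)"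
      unfolding act_def f_def by (simp add: sum_distrib_left mult_ac) (rule sum.swap)
    have "(\<Sum>i<Suc k. c i * G i w) = f w + (if w = u then x else 0) + (if w = v then c k else 0)" for w
    proof -
      have "(\<Sum>i<k. c i * G i w) = f w + (\<Sum>i<k. c i * (if w = u then - a u v * act (F i) v else 0))"
        by (simp add: G_def f_def distrib_left sum.distrib)
      also have "(\<Sum>i<k. c i * (if w = u then - a u v * act (F i) v else 0))
          = (if w = u then - a u v * act f v else 0)"
        by (simp add: actf sum_distrib_left sum_negf mult_ac)
      finally show ?thesis by (simp add: G_def x_def algebra_simps)
    qed
    moreover have "bil (\<lambda>w. f w + (if w = u then x else 0) + (if w = v then c k else 0))
        (\<lambda>w. f w + (if w = u then x else 0) + (if w = v then c k else 0)) = bil f f - 2 * (c k)\<^sup>2"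
    proof -
      have fu: "act f u = 0"
        unfolding act_def
      proof (rule sum.neutral, intro ballI)
        fix w show "a u w * f w = 0"
          using uT[of w] F(1) by (cases "w \<in> T") (auto simp: f_def)
      qed
      have "x * a v u = - act f v - c k"
        using vals[OF uv] sym[of u v] by (simp add: x_def algebra_simps)
      then show ?thesis
        using u v by (simp add: bil_square_add_point act_add act_point fu mult.commute)
          (simp add: power2_eq_square algebra_simps)
    qed
    moreover have "bil f f - 2 * (c k)\<^sup>2 < 0"
    proof (cases "\<exists>i<k. c i \<noteq> 0")
      case True
      from F(2)[OF True] have "bil f f < 0" by (simp add: neg_def f_def[abs_def])
      then show ?thesis by (smt (verit) zero_le_power2)
    next
      case False
      then have "bil f f = 0" by (simp add: f_def bil_def)
      moreover have "c k \<noteq> 0" using c False by (auto simp: less_Suc_eq)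
      ultimately show ?thesis by simp
    qed
    ultimately show "neg (\<lambda>w. \<Sum>i<Suc k. c i * G i w)" by (simp add: neg_def)
  qed (use F(1) in \<open>auto simp: G_def\<close>)
qed

definition indep :: "'a set \<Rightarrow> bool" where
  "indep S \<longleftrightarrow> (\<forall>u\<in>S. \<forall>v\<in>S. a u v = 0)"

text \<open>A vector \<open>z\<close> on \<open>P\<close> is completed by \<open>-Az\<close> on \<open>Q\<close>, which gives the value \<open>-2 |Az|\<^sup>2\<close>.\<close>

lemma fam_neg_bipartite:
  assumes "P \<subseteq> V" "Q \<subseteq> V" "P \<inter> Q = {}" "indep P" "indep Q"
    and inj: "\<And>z. \<lbrakk>\<And>v. v \<notin> P \<Longrightarrow> z v = 0; \<And>v. v \<in> Q \<Longrightarrow> act z v = 0\<rbrakk> \<Longrightarrow> z = (\<lambda>_. 0)"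
  shows "fam neg (P \<union> Q) (card P)"
proof (rule famI[where F = "\<lambda>p w. (if w = p then 1 else 0) + (if w \<in> Q then - a w p else 0)"])
  show "finite P" using assms(1) finV by (rule finite_subset)
  fix c :: "'a \<Rightarrow> real" assume c: "\<exists>i\<in>P. c i \<noteq> 0"
  define z where "z w = (if w \<in> P then c w else 0)" for w
  define y where "y w = (if w \<in> Q then - act z w else 0)" for w
  have az: "act z w = (\<Sum>p\<in>P. c p * a w p)" for w
  proof -
    have "act z w = (\<Sum>p\<in>P. a w p * z p)"
      unfolding act_def using assms(1) finV by (intro sum.mono_neutral_right) (auto simp: z_def)
    then show ?thesis by (simp add: z_def mult.commute)
  qed
  have comb: "(\<Sum>p\<in>P. c p * ((if w = p then 1 else 0) + (if w \<in> Q then - a w p else 0))) = z w + y w" for w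
    using \<open>finite P\<close> by (auto simp: distrib_left sum.distrib z_def y_def az sum_negf
      if_distrib[of "\<lambda>t. _ * t"] cong: if_cong)
  have "bil z z = 0" using assms(4) by (intro bil_eq_0) (auto simp: z_def indep_def split: if_splits)
  moreover have "bil y y = 0" using assms(5) by (intro bil_eq_0) (auto simp: y_def indep_def split: if_splits)
  moreover have "bil y z = - (\<Sum>w\<in>Q. (act z w)\<^sup>2)"
  proof -
    have "bil y z = (\<Sum>w\<in>Q. y w * act z w)"
      unfolding bil_def using assms(2) finV by (intro sum.mono_neutral_right) (auto simp: y_def)
    then show ?thesis by (simp add: y_def power2_eq_square sum_negf)
  qed
  moreover have "(\<Sum>w\<in>Q. (act z w)\<^sup>2) > 0"
  proof -
    have "\<exists>w\<in>Q. act z w \<noteq> 0"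
    proof (rule ccontr)
      assume "\<not> ?thesis"
      then have "z = (\<lambda>_. 0)" by (intro inj) (auto simp: z_def)
      then have "z v = 0" for v by (rule fun_cong)
      moreover obtain i where "i \<in> P" "c i \<noteq> 0" using c by blast
      ultimately show False by (metis z_def)
    qed
    moreover have "finite Q" using assms(2) finV by (rule finite_subset)
    ultimately show ?thesis by (auto intro: sum_pos2)
  qed
  ultimately show "neg (\<lambda>w. \<Sum>p\<in>P. c p * ((if w = p then 1 else 0) + (if w \<in> Q then - a w p else 0)))"
    by (simp add: comb neg_def bil_square_add bil_sym[of z y])
qed auto

text \<open>The point vectors of the independent set \<open>Q\<close> span an isotropic subspace.
  The vector \<open>z\<close> is isotropic as well, being supported on \<open>P\<close>, and it is
  orthogonal to that subspace because its image vanishes on \<open>Q\<close>; adding it keeps the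
  span isotropic.\<close>

lemma fam_nonneg_bipartite:
  assumes "P \<subseteq> V" "Q \<subseteq> V" "P \<inter> Q = {}" "indep P" "indep Q"
    and z: "\<And>v. v \<notin> P \<Longrightarrow> z v = 0" "\<And>v. v \<in> Q \<Longrightarrow> act z v = 0" and p: "z p \<noteq> 0"
  shows "fam nonneg (P \<union> Q) (Suc (card Q))"
proof -
  have pP: "p \<in> P" using p z(1) by blast
  have fQ: "finite Q" using assms(2) finV by (rule finite_subset)
  have pQ: "p \<notin> Q" using pP assms(3) by auto
  \<comment> \<open>The vertex \<open>p\<close> outside \<open>Q\<close> serves as the index of the
    extra vector \<open>z\<close>.\<close>
  have "fam nonneg (P \<union> Q) (card (insert p Q))"
  proof (rule famI[where F = "\<lambda>q w. if q = p then z w else if w = q then 1 else 0"])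
    fix c :: "'a \<Rightarrow> real" assume c: "\<exists>i\<in>insert p Q. c i \<noteq> 0"
    define y where "y w = (if w \<in> Q then c w else 0)" for w
    have "(\<Sum>q\<in>Q. c q * (if q = p then z w else if w = q then 1 else 0)) = (\<Sum>q\<in>Q. if q = w then c q else 0)" for w
      using pQ by (intro sum.cong) auto
    then have comb: "(\<Sum>q\<in>insert p Q. c q * (if q = p then z w else if w = q then 1 else 0)) = y w + c p * z w" for w
      using fQ pQ by (simp add: y_def)
    have "bil y y = 0" using assms(5) by (intro bil_eq_0) (auto simp: y_def indep_def split: if_splits)
    moreover have "bil z z = 0" using assms(4) z(1) by (intro bil_eq_0) (metis indep_def)
    moreover have "bil y z = 0"
      unfolding bil_def by (rule sum.neutral) (auto simp: y_def z(2))
    ultimately have "bil (\<lambda>w. y w + c p * z w) (\<lambda>w. y w + c p * z w) = 0"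
      by (simp add: bil_square_add bil_scale_left bil_scale_right)
    moreover have "\<exists>w\<in>V. y w + c p * z w \<noteq> 0"
    proof (cases "c p = 0")
      case True
      with c obtain q where q: "q \<in> Q" "c q \<noteq> 0" by auto
      then show ?thesis using True assms(2) by (intro bexI[of _ q]) (auto simp: y_def)
    next
      case False
      then show ?thesis using p pQ pP assms(1) by (intro bexI[of _ p]) (auto simp: y_def)
    qed
    ultimately show "nonneg (\<lambda>w. \<Sum>q\<in>insert p Q. c q * (if q = p then z w else if w = q then 1 else 0))"
      by (simp only: comb nonneg_def) simp
  qed (use fQ z(1) in auto)
  then show ?thesis using fQ pQ by simp
qed

end

section \<open>Signed cycles\<close>

lemma Suc_mod_eq: "i < m \<Longrightarrow> Suc i mod m = (if Suc i = m then 0 else Suc i)"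
  by auto

text \<open>The factors are paired as \<open>transport\<close> uses them: edges 2t + 1 and 2t + 2
  meet at the vertex of index 2t + 2, and the two edges left over meet at vertex 0.\<close>

lemma prod_even_split:
  fixes s :: "nat \<Rightarrow> real"
  shows "(\<Prod>i<2 * g + 2. s i) = s 0 * s (2 * g + 1) * (\<Prod>t<g. s (2 * t + 1) * s (2 * t + 2))"
proof (induction g)
  case (Suc g)
  have "(\<Prod>i<2 * Suc g + 2. s i) = (\<Prod>i<2 * g + 2. s i) * s (2 * g + 2) * s (2 * g + 3)"
    by (simp add: numeral_3_eq_3)
  also have "\<dots> = s 0 * s (2 * g + 1) * (\<Prod>t<g. s (2 * t + 1) * s (2 * t + 2)) * s (2 * g + 2) * s (2 * g + 3)"
    by (simp only: Suc.IH)
  also have "\<dots> = s 0 * s (2 * Suc g + 1) * (\<Prod>t<Suc g. s (2 * t + 1) * s (2 * t + 2))"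
    by (simp add: numeral_3_eq_3 mult_ac)
  finally show ?case .
qed (simp add: numeral_2_eq_2)

text \<open>As \<open>s 0\<close> is a sign, the closing equation says that \<open>s 0\<close> times
  the second summand is -1. The g steps contribute (-1)^g and the closing equation one more factor
  -1, so the exponent is half the length.\<close>

lemma alternating_product_closes:
  fixes s :: "nat \<Rightarrow> real"
  assumes "s 0 * s 0 = 1"
  shows "s 0 + s (2 * g + 1) * (\<Prod>t<g. - (s (2 * t + 1) * s (2 * t + 2))) = 0
    \<longleftrightarrow> (\<Prod>i<2 * g + 2. s i) = (-1) ^ Suc g"
proof -
  define x where "x = s (2 * g + 1) * (\<Prod>t<g. - (s (2 * t + 1) * s (2 * t + 2)))"
  have "(\<Prod>t<g. - (s (2 * t + 1) * s (2 * t + 2))) = (\<Prod>t<g. (-1) * (s (2 * t + 1) * s (2 * t + 2)))"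
    by simp
  also have "\<dots> = (-1) ^ g * (\<Prod>t<g. s (2 * t + 1) * s (2 * t + 2))"
    by (simp only: prod.distrib prod_constant card_lessThan)
  finally have "s 0 * x = (-1) ^ g * (\<Prod>i<2 * g + 2. s i)"
    unfolding prod_even_split x_def by simp
  moreover have "((-1::real) ^ g) * (-1) ^ g = 1" by (simp flip: power_add)
  ultimately have P: "(\<Prod>i<2 * g + 2. s i) = (-1) ^ g * (s 0 * x)" by simp
  have "s 0 + x = 0 \<longleftrightarrow> s 0 * x = -1"
  proof
    assume "s 0 + x = 0"
    then have "x = - s 0" by simp
    then show "s 0 * x = -1" using assms by simp
  next
    assume *: "s 0 * x = -1"
    have "x = (s 0 * s 0) * x" using assms by simp
    also have "\<dots> = - s 0" using * by (simp add: mult.assoc)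
    finally show "s 0 + x = 0" by simp
  qed
  also have "\<dots> \<longleftrightarrow> (-1) ^ g * (s 0 * x) = (-1) ^ g * (-1)"
    by (subst mult_cancel_left) simp
  finally show ?thesis unfolding P x_def by (simp only: power_Suc2)
qed

context signed_weights
begin

text \<open>The equivalence also excludes chords, so this is an induced cycle and
  \<open>set vs\<close> determines all of its edges.\<close>

definition cyc :: "'a list \<Rightarrow> bool" where
  "cyc vs \<longleftrightarrow> distinct vs \<and> length vs \<ge> 3 \<and>
     (\<forall>i<length vs. \<forall>j<length vs. a (vs ! i) (vs ! j) \<noteq> 0 \<longleftrightarrow>
        j = Suc i mod length vs \<or> i = Suc j mod length vs)"

definition wt :: "'a list \<Rightarrow> nat \<Rightarrow> real" where
  "wt vs i = a (vs ! i) (vs ! (Suc i mod length vs))"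

text \<open>With h half the length, the sign has to be (-1)^h. This merges the balanced and the
  unbalanced congruence modulo 4 into one equation, and it is the case in which the biadjacency
  matrix is singular.\<close>

definition good :: "'a list \<Rightarrow> bool" where
  "good vs \<longleftrightarrow> cyc vs \<and> even (length vs) \<and> (\<Prod>i<length vs. wt vs i) = (-1) ^ (length vs div 2)"

lemma wt_square:
  assumes "cyc vs" "i < length vs"
  shows "wt vs i * wt vs i = 1"
proof -
  have "Suc i mod length vs < length vs" using assms by (intro mod_less_divisor) auto
  then have "wt vs i \<noteq> 0" using assms unfolding cyc_def wt_def by blast
  then show ?thesis unfolding wt_def by (rule vals)
qed

text \<open>The vertex is addressed through its predecessor \<open>i\<close>, so both neighbours are
  reached by successors and no subtraction modulo the length is needed.\<close>

lemma act_cyc: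
  assumes c: "cyc vs" and V: "set vs \<subseteq> V" and z: "\<forall>v. v \<notin> set vs \<longrightarrow> z v = 0" and i: "i < length vs"
  defines "k \<equiv> Suc i mod length vs"
  shows "act z (vs ! k) = wt vs i * z (vs ! i) + wt vs k * z (vs ! (Suc k mod length vs))"
proof -
  define m where "m = length vs"
  define l where "l = Suc k mod m"
  have m: "m \<ge> 3" "distinct vs" using c by (auto simp: cyc_def m_def)
  have k: "k < m" and l: "l < m" using m by (auto simp: k_def l_def m_def[symmetric])
  have il: "i \<noteq> l" using i m by (auto simp: l_def k_def m_def[symmetric] Suc_mod_eq split: if_splits)
  have nb: "a (vs ! k) (vs ! j) \<noteq> 0 \<longleftrightarrow> j = l \<or> j = i" if "j < m" for j
  proof -
    have "a (vs ! k) (vs ! j) \<noteq> 0 \<longleftrightarrow> j = l \<or> k = Suc j mod m"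
      using c that k unfolding cyc_def l_def m_def by blast
    also have "k = Suc j mod m \<longleftrightarrow> j = i"
      using that i by (auto simp: k_def m_def Suc_mod_eq split: if_splits)
    finally show ?thesis .
  qed
  have "act z (vs ! k) = (\<Sum>v\<in>set vs. a (vs ! k) v * z v)"
    unfolding act_def using V finV z by (intro sum.mono_neutral_right) auto
  also have "\<dots> = (\<Sum>j<m. a (vs ! k) (vs ! j) * z (vs ! j))"
    using sum.reindex_bij_betw[OF bij_betw_nth[OF m(2) refl refl], of "\<lambda>v. a (vs ! k) v * z v"]
    by (simp add: m_def)
  also have "\<dots> = (\<Sum>j\<in>{i, l}. a (vs ! k) (vs ! j) * z (vs ! j))"
    using nb i l by (intro sum.mono_neutral_right) (auto simp: m_def)
  also have "\<dots> = wt vs i * z (vs ! i) + wt vs k * z (vs ! l)"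
    using il by (simp add: wt_def k_def l_def m_def sym)
  finally show ?thesis by (simp add: l_def m_def)
qed

text \<open>The value at the vertex of index \<open>2j + 1\<close> of the vector on the odd vertices that has value \<open>1\<close>
  at index \<open>1\<close> and is annihilated by the rows of the vertices with even index \<open>2, \<dots>, 2j\<close>.\<close>

definition transport :: "'a list \<Rightarrow> nat \<Rightarrow> real" where
  "transport vs j = (\<Prod>t<j. - (wt vs (2 * t + 1) * wt vs (2 * t + 2)))"

text \<open>The left-hand side is the row of vertex 0 applied to the transported vector. It is the
  only even row that \<open>transport\<close> leaves open, so it decides whether a kernel vector
  exists.\<close>

lemma transport_closes:
  assumes "cyc vs" "length vs = 2 * g + 2"
  shows "wt vs 0 + wt vs (2 * g + 1) * transport vs g = 0 \<longleftrightarrow>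
    (\<Prod>i<length vs. wt vs i) = (-1) ^ (length vs div 2)"
  using alternating_product_closes[of "wt vs" g] wt_square[OF assms(1), of 0] assms(2)
  by (simp add: transport_def)

text \<open>A step to the next index modulo an even length changes parity, so the index parities are
  the two colour classes.\<close>

lemma even_cycle_bipartition:
  assumes c: "cyc vs" and m: "length vs = 2 * h"
  defines "P \<equiv> (\<lambda>j. vs ! (2 * j + 1)) ` {..<h}" and "Q \<equiv> (\<lambda>j. vs ! (2 * j)) ` {..<h}"
  shows "set vs = P \<union> Q" "P \<inter> Q = {}" "indep P" "indep Q" "card P = h" "card Q = h"
proof -
  have d: "distinct vs" using c by (simp add: cyc_def)
  show "set vs = P \<union> Q"
  proof
    show "set vs \<subseteq> P \<union> Q"
    proof
      fix v assume "v \<in> set vs"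
      then obtain i where i: "i < 2 * h" "v = vs ! i" using m by (auto simp: in_set_conv_nth)
      then show "v \<in> P \<union> Q"
        by (cases "even i") (auto simp: P_def Q_def elim!: evenE oddE)
    qed
    show "P \<union> Q \<subseteq> set vs" using m by (auto simp: P_def Q_def)
  qed
  show "P \<inter> Q = {}"
  proof (rule ccontr)
    assume "P \<inter> Q \<noteq> {}"
    then obtain i j where "i < h" "j < h" "vs ! (2 * i + 1) = vs ! (2 * j)" by (auto simp: P_def Q_def)
    then have "2 * i + 1 = 2 * j" using d m nth_eq_iff_index_eq[of vs "2 * i + 1" "2 * j"] by simp
    then show False by presburger
  qed
  have par: "a (vs ! i) (vs ! j) = 0" if "i < 2 * h" "j < 2 * h" "even i = even j" for i j
  proof (rule ccontr)
    assume "a (vs ! i) (vs ! j) \<noteq> 0"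
    then have "j = Suc i mod (2 * h) \<or> i = Suc j mod (2 * h)"
      using c that unfolding cyc_def m by blast
    then show False using that by (auto simp: Suc_mod_eq split: if_splits) presburger+
  qed
  show "indep P" "indep Q" unfolding indep_def P_def Q_def by (auto intro!: par)
  have "inj_on (\<lambda>j. vs ! (2 * j + 1)) {..<h}" "inj_on (\<lambda>j. vs ! (2 * j)) {..<h}"
    using d m by (auto simp: inj_on_def nth_eq_iff_index_eq)
  then show "card P = h" "card Q = h" by (auto simp: P_def Q_def card_image)
qed

lemma act_even_cycle:
  assumes c: "cyc vs" and m: "length vs = 2 * g + 2" and V: "set vs \<subseteq> V"
    and z: "\<forall>v. v \<notin> set vs \<longrightarrow> z v = 0"
  shows "act z (vs ! 0) = wt vs (2 * g + 1) * z (vs ! (2 * g + 1)) + wt vs 0 * z (vs ! 1)"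
    and "j < g \<Longrightarrow> act z (vs ! (2 * j + 2)) = wt vs (2 * j + 1) * z (vs ! (2 * j + 1)) + wt vs (2 * j + 2) * z (vs ! (2 * j + 3))"
  using act_cyc[OF c V z, of "2 * g + 1"] act_cyc[OF c V z, of "2 * j + 1"] m
  by (simp_all add: numeral_3_eq_3)

text \<open>A vector on \<open>P\<close> killed by the rows of \<open>Q\<close> is determined by its
  value at index 1 through \<open>transport\<close>. In a cycle that is not good the closing row
  forces that value to be 0, so the kernel is trivial.\<close>

lemma fam_neg_even_cycle:
  assumes c: "cyc vs" and V: "set vs \<subseteq> V" and ev: "even (length vs)" and bad: "\<not> good vs"
  shows "fam neg (set vs) (length vs div 2)"
proof -
  obtain g where m: "length vs = 2 * g + 2"
  proof -
    obtain h where "length vs = 2 * h" using ev by (elim evenE)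
    moreover have "h \<noteq> 0" using c calculation by (auto simp: cyc_def)
    ultimately show ?thesis using that[of "h - 1"] by simp
  qed
  define P where "P = (\<lambda>j. vs ! (2 * j + 1)) ` {..<g + 1}"
  define Q where "Q = (\<lambda>j. vs ! (2 * j)) ` {..<g + 1}"
  note PQ = even_cycle_bipartition[OF c, of "g + 1", folded P_def Q_def]
  have PQ: "set vs = P \<union> Q" "P \<inter> Q = {}" "indep P" "indep Q" "card P = g + 1"
    using PQ m by auto
  have "fam neg (P \<union> Q) (card P)"
  proof (rule fam_neg_bipartite)
    fix z assume z: "\<And>v. v \<notin> P \<Longrightarrow> z v = 0" "\<And>v. v \<in> Q \<Longrightarrow> act z v = 0"
    have zv: "\<forall>v. v \<notin> set vs \<longrightarrow> z v = 0" using z(1) PQ by auto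
    note act = act_even_cycle[OF c m V zv]
    have step: "z (vs ! (2 * j + 1)) = transport vs j * z (vs ! 1)" if "j \<le> g" for j
      using that
    proof (induction j)
      case (Suc j)
      then have "vs ! (2 * j + 2) \<in> Q" unfolding Q_def by (intro image_eqI[of _ _ "j + 1"]) auto
      then have "wt vs (2 * j + 1) * z (vs ! (2 * j + 1)) + wt vs (2 * j + 2) * z (vs ! (2 * j + 3)) = 0"
        using z(2) act(2)[of j] Suc.prems by simp
      \<comment> \<open>Multiplication by a weight with square 1 replaces division when solving for
        the next value.\<close>
      then have "wt vs (2 * j + 2) * (wt vs (2 * j + 1) * z (vs ! (2 * j + 1)) + wt vs (2 * j + 2) * z (vs ! (2 * j + 3))) = 0"
        by (simp only: mult_zero_right)
      then have "wt vs (2 * j + 2) * (wt vs (2 * j + 2) * z (vs ! (2 * j + 3))) =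
          - (wt vs (2 * j + 2) * (wt vs (2 * j + 1) * z (vs ! (2 * j + 1))))"
        by (simp only: distrib_left eq_neg_iff_add_eq_0 add.commute)
      then have "z (vs ! (2 * j + 3)) = - (wt vs (2 * j + 2) * (wt vs (2 * j + 1) * z (vs ! (2 * j + 1))))"
        using wt_square[OF c, of "2 * j + 2"] Suc.prems m by (simp flip: mult.assoc)
      then show ?case using Suc by (simp add: transport_def numeral_3_eq_3 mult_ac)
    qed (simp add: transport_def)
    have "vs ! 0 \<in> Q" unfolding Q_def by (intro image_eqI[of _ _ 0]) auto
    then have "wt vs (2 * g + 1) * (transport vs g * z (vs ! 1)) + wt vs 0 * z (vs ! 1) = 0"
      using z(2) act(1) step[of g] by simp
    then have "(wt vs 0 + wt vs (2 * g + 1) * transport vs g) * z (vs ! 1) = 0"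
      by (simp add: algebra_simps)
    moreover have "wt vs 0 + wt vs (2 * g + 1) * transport vs g \<noteq> 0"
      using bad c ev transport_closes[OF c m] by (simp add: good_def)
    ultimately have "z (vs ! 1) = 0" by simp
    then have "z v = 0" if "v \<in> P" for v using that step by (auto simp: P_def)
    then show "z = (\<lambda>_. 0)" using z(1) by blast
  qed (use PQ V in auto)
  then show ?thesis using PQ m by simp
qed

lemma fam_nonneg_good_cycle:
  assumes good: "good vs" and V: "set vs \<subseteq> V"
  shows "fam nonneg (set vs) (Suc (length vs div 2))"
proof -
  have c: "cyc vs" and ev: "even (length vs)" using good by (auto simp: good_def)
  obtain g where m: "length vs = 2 * g + 2"
  proof -
    obtain h where "length vs = 2 * h" using ev by (elim evenE)
    moreover have "h \<noteq> 0" using c calculation by (auto simp: cyc_def)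
    ultimately show ?thesis using that[of "h - 1"] by simp
  qed
  define P where "P = (\<lambda>j. vs ! (2 * j + 1)) ` {..<g + 1}"
  define Q where "Q = (\<lambda>j. vs ! (2 * j)) ` {..<g + 1}"
  note PQ = even_cycle_bipartition[OF c, of "g + 1", folded P_def Q_def]
  have PQ: "set vs = P \<union> Q" "P \<inter> Q = {}" "indep P" "indep Q" "card Q = g + 1"
    using PQ m by auto
  \<comment> \<open>A vertex of \<open>P\<close> has odd index 2j + 1; halving it recovers the
    number j of transport steps.\<close>
  define z where "z v = (if v \<in> P then transport vs ((THE i. i < length vs \<and> vs ! i = v) div 2) else 0)" for v
  have zP: "z (vs ! (2 * j + 1)) = transport vs j" if "j \<le> g" for j
  proof -
    have "(THE i. i < length vs \<and> vs ! i = vs ! (2 * j + 1)) = 2 * j + 1"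
      using c m that by (intro the_equality) (auto simp: cyc_def nth_eq_iff_index_eq)
    moreover have "vs ! (2 * j + 1) \<in> P" using that by (auto simp: P_def)
    ultimately show ?thesis by (simp add: z_def)
  qed
  have zv: "\<forall>v. v \<notin> set vs \<longrightarrow> z v = 0" using PQ by (auto simp: z_def)
  note act = act_even_cycle[OF c m V zv]
  have "fam nonneg (P \<union> Q) (Suc (card Q))"
  proof (rule fam_nonneg_bipartite)
    show "z v = 0" if "v \<notin> P" for v using that by (simp add: z_def)
    show "z (vs ! 1) \<noteq> 0" using zP[of 0] by (simp add: transport_def)
    fix v assume "v \<in> Q"
    then obtain j where j: "j \<le> g" "v = vs ! (2 * j)" by (auto simp: Q_def less_Suc_eq_le)
    show "act z v = 0"
    proof (cases j)
      case 0
      have "wt vs 0 + wt vs (2 * g + 1) * transport vs g = 0"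
        using transport_closes[OF c m] good by (simp add: good_def)
      then show ?thesis using 0 j act(1) zP[of g] zP[of 0] by (simp add: transport_def)
    next
      case (Suc i)
      have "wt vs (2 * i + 2) * transport vs (Suc i)
          = - (wt vs (2 * i + 2) * wt vs (2 * i + 2)) * (wt vs (2 * i + 1) * transport vs i)"
        by (simp add: transport_def)
      also have "\<dots> = - (wt vs (2 * i + 1) * transport vs i)"
        using wt_square[OF c, of "2 * i + 2"] j m Suc by simp
      finally show ?thesis
        using Suc j act(2)[of i] zP[of i] zP[of "Suc i"] by (simp add: numeral_3_eq_3)
    qed
  qed (use PQ V in auto)
  then show ?thesis using PQ m by simp
qed

section \<open>The lower bound for connected graphs\<close>

text \<open>The closure is reflexive on the whole type, so a vertex outside \<open>S\<close> is
  related to itself; this is why lemmas on components ask for a starting point in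
  \<open>S\<close>.\<close>

definition conn :: "'a set \<Rightarrow> ('a \<times> 'a) set" where
  "conn S = {(x, y). x \<in> S \<and> y \<in> S \<and> a x y \<noteq> 0}\<^sup>*"

definition comp :: "'a set \<Rightarrow> 'a \<Rightarrow> 'a set" where
  "comp S x = {y. (x, y) \<in> conn S}"

definition connected :: "'a set \<Rightarrow> bool" where
  "connected K \<longleftrightarrow> (\<forall>x\<in>K. \<forall>y\<in>K. (x, y) \<in> conn K)"

definition nbrs :: "'a set \<Rightarrow> 'a \<Rightarrow> 'a set" where
  "nbrs K v = {u \<in> K. a v u \<noteq> 0}"

abbreviation deg :: "'a set \<Rightarrow> 'a \<Rightarrow> nat" where
  "deg K v \<equiv> card (nbrs K v)"

lemma conn_refl [simp]: "(x, x) \<in> conn S"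
  by (simp add: conn_def)

lemma conn_step: "x \<in> S \<Longrightarrow> y \<in> S \<Longrightarrow> a x y \<noteq> 0 \<Longrightarrow> (x, y) \<in> conn S"
  by (auto simp: conn_def)

lemma conn_trans: "(x, y) \<in> conn S \<Longrightarrow> (y, z) \<in> conn S \<Longrightarrow> (x, z) \<in> conn S"
  by (simp add: conn_def)

lemma conn_sym: "(x, y) \<in> conn S \<Longrightarrow> (y, x) \<in> conn S"
  unfolding conn_def by (rule symD[OF sym_rtrancl]) (auto simp: Relation.sym_def sym)

lemma conn_induct [consumes 1, case_names refl step]:
  assumes "(x, y) \<in> conn S" "P x"
    "\<And>y z. (x, y) \<in> conn S \<Longrightarrow> y \<in> S \<Longrightarrow> z \<in> S \<Longrightarrow> a y z \<noteq> 0 \<Longrightarrow> P y \<Longrightarrow> P z"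
  shows "P y"
  using assms(1) unfolding conn_def
  by (induction rule: rtrancl_induct) (use assms(2,3) in \<open>auto simp: conn_def\<close>)

lemma comp_self: "x \<in> comp S x"
  by (simp add: comp_def)

lemma comp_subset:
  assumes "x \<in> S"
  shows "comp S x \<subseteq> S"
proof
  fix y assume "y \<in> comp S x"
  then have "(x, y) \<in> conn S" by (simp add: comp_def)
  then show "y \<in> S" by (induction rule: conn_induct) (use assms in auto)
qed

lemma comp_eq: "y \<in> comp S x \<Longrightarrow> comp S y = comp S x"
  unfolding comp_def by (auto intro: conn_trans conn_sym)

lemma comp_closed: "y \<in> comp S x \<Longrightarrow> y \<in> S \<Longrightarrow> z \<in> S \<Longrightarrow> a y z \<noteq> 0 \<Longrightarrow> z \<in> comp S x"
  unfolding comp_def by (auto intro: conn_trans conn_step)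

lemma connected_comp:
  assumes "x \<in> S"
  shows "connected (comp S x)"
proof -
  have *: "(x, y) \<in> conn (comp S x)" if "y \<in> comp S x" for y
  proof -
    from that have "(x, y) \<in> conn S" by (simp add: comp_def)
    then show ?thesis
    proof (induction rule: conn_induct)
      case (step y z)
      then have "y \<in> comp S x" by (simp add: comp_def)
      moreover from this have "z \<in> comp S x" using step by (auto intro: comp_closed)
      ultimately show ?case using step by (auto intro: conn_trans conn_step)
    qed simp
  qed
  then show ?thesis unfolding connected_def by (blast intro: conn_trans conn_sym)
qed

lemma separated_comp:
  assumes "x \<in> S" "y \<in> S" "comp S x \<noteq> comp S y"
  shows "separated (comp S x) (comp S y)"
proof -
  have "comp S x \<inter> comp S y = {}" using assms(3) comp_eq by blast
  then show ?thesis unfolding separated_def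
    using comp_closed comp_subset[OF assms(1)] comp_subset[OF assms(2)] by blast
qed

lemma pairwise_separated_comps: "pairwise separated (comp S ` S)"
  unfolding pairwise_def using separated_comp by blast

lemma Union_comps: "\<Union>(comp S ` S) = S"
  using comp_subset comp_self by blast

lemma sum_over_comps:
  assumes "finite S"
  shows "sum f S = (\<Sum>K\<in>comp S ` S. sum f K)"
proof -
  have "sum f (\<Union>(comp S ` S)) = (\<Sum>K\<in>comp S ` S. sum f K)"
  proof (rule sum.Union_disjoint[unfolded o_def])
    show "\<forall>A\<in>comp S ` S. finite A" using comp_subset assms by (auto intro: finite_subset)
    show "\<forall>A\<in>comp S ` S. \<forall>B\<in>comp S ` S. A \<noteq> B \<longrightarrow> A \<inter> B = {}"
      using pairwise_separated_comps[of S] unfolding pairwise_def separated_def by blast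
  qed
  then show ?thesis by (simp only: Union_comps)
qed

lemma nbrs_nonempty:
  assumes "connected K" "v \<in> K" "card K \<ge> 2"
  shows "nbrs K v \<noteq> {}"
proof -
  have "K \<noteq> {v}" using assms(3) by auto
  then obtain u where u: "u \<in> K" "u \<noteq> v" using assms(2) by blast
  then have "(v, u) \<in> conn K" using assms by (simp add: connected_def)
  then have "u = v \<or> nbrs K v \<noteq> {}"
    by (induction rule: conn_induct) (auto simp: nbrs_def)
  with u show ?thesis by simp
qed

section \<open>Degree weights and the effect of deleting vertices\<close>

definition weight :: "nat \<Rightarrow> int" where
  "weight d = (if d = 0 then 0 else if d = 1 then 1 else 3 - int d)"

definition good_set :: "'a set \<Rightarrow> bool" where
  "good_set K \<longleftrightarrow> (\<exists>vs. set vs = K \<and> good vs)"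

definition inertia_bounded :: "'a set \<Rightarrow> bool" where
  "inertia_bounded K \<longleftrightarrow> (\<exists>k. fam neg K k \<and>
    ((\<Sum>v\<in>K. weight (deg K v)) - 1 \<le> 2 * int k \<or>
     good_set K \<and> (\<Sum>v\<in>K. weight (deg K v)) - 2 \<le> 2 * int k))"

lemma deg_cyc:
  assumes c: "cyc vs" and v: "v \<in> set vs"
  shows "deg (set vs) v = 2"
proof -
  define m where "m = length vs"
  have m: "m \<ge> 3" "distinct vs" using c by (auto simp: cyc_def m_def)
  obtain i where i: "i < m" "v = vs ! i" using v by (auto simp: in_set_conv_nth m_def)
  define j where "j = Suc i mod m"
  define l where "l = (if i = 0 then m - 1 else i - 1)"
  have jl: "j < m" "l < m" "j \<noteq> l" using i m
    by (auto simp: j_def l_def Suc_mod_eq split: if_splits)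
  have "a v (vs ! t) \<noteq> 0 \<longleftrightarrow> t = j \<or> t = l" if "t < m" for t
  proof -
    have "a v (vs ! t) \<noteq> 0 \<longleftrightarrow> t = j \<or> i = Suc t mod m"
      using c i that unfolding cyc_def j_def m_def by blast
    also have "i = Suc t mod m \<longleftrightarrow> t = l"
      using that i m by (auto simp: l_def Suc_mod_eq split: if_splits)
    finally show ?thesis .
  qed
  then have "nbrs (set vs) v = {vs ! j, vs ! l}"
    using jl by (auto simp: nbrs_def in_set_conv_nth m_def)
  then show ?thesis using jl m by (simp add: nth_eq_iff_index_eq m_def)
qed

text \<open>Degrees 1 and 2 both have weight 1, and from 2 upwards each further degree costs
  1.\<close>

lemma weight_drop:
  assumes "d \<ge> 1"
  shows "weight (Suc d) + (if Suc d \<ge> 3 then 1 else 0) = weight d"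
  using assms by (auto simp: weight_def)

text \<open>Removing \<open>x\<close> lowers the degree of each neighbour by one, which raises its weight exactly
  when that degree was at least \<open>3\<close>. A good cycle \<open>L\<close> falls short by \<open>2\<close>, but then all neighbours
  of \<open>x\<close> in \<open>L\<close> had degree \<open>3\<close>, which makes up for the loss.\<close>

lemma component_bound:
  assumes KV: "K \<subseteq> V" and LK: "L \<subseteq> K" and xK: "x \<in> K - L" and conL: "connected L"
    and out: "\<And>y z. y \<in> L \<Longrightarrow> z \<in> K - L \<Longrightarrow> a y z \<noteq> 0 \<Longrightarrow> z = x"
    and nb: "\<exists>y\<in>L. a y x \<noteq> 0"
    and IH: "card L \<ge> 2 \<Longrightarrow> inertia_bounded L"
  shows "\<exists>k. fam neg L k \<and> (\<Sum>v\<in>L. weight (deg K v)) -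
    (if \<exists>y\<in>L. \<exists>z\<in>L. y \<noteq> z \<and> a y x \<noteq> 0 \<and> a z x \<noteq> 0 \<and> deg K y \<ge> 3 then 0 else 1) \<le> 2 * int k"
    (is "\<exists>k. _ \<and> ?W - ?e \<le> _")
proof -
  have fK: "finite K" using KV finV by (rule finite_subset)
  have fL: "finite L" using LK fK by (rule finite_subset)
  obtain y0 where y0: "y0 \<in> L" "a y0 x \<noteq> 0" using nb by auto
  define X where "X = {v \<in> L. a v x \<noteq> 0}"
  have degK: "deg K v = (if v \<in> X then Suc (deg L v) else deg L v)" if "v \<in> L" for v
  proof -
    have "u \<in> nbrs K v \<longleftrightarrow> u \<in> nbrs L v \<or> u = x \<and> v \<in> X" for u
    proof (cases "u \<in> L")
      case True
      then show ?thesis using LK xK by (auto simp: nbrs_def)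
    next
      case False
      have "u \<in> K \<and> a v u \<noteq> 0 \<longleftrightarrow> u = x \<and> a v x \<noteq> 0"
        using out[OF that, of u] False xK by blast
      then show ?thesis using False that by (simp add: nbrs_def X_def)
    qed
    then have "nbrs K v = (if v \<in> X then insert x (nbrs L v) else nbrs L v)" by auto
    moreover have "x \<notin> nbrs L v" "finite (nbrs L v)" using xK fL by (auto simp: nbrs_def)
    ultimately show ?thesis by simp
  qed
  show ?thesis
  proof (cases "card L \<ge> 2")
    case False
    moreover have "card L > 0" using y0 fL by (auto simp: card_gt_0_iff)
    ultimately have "card L = 1" by simp
    then have L: "L = {y0}" using y0 by (auto simp: card_1_singleton_iff)
    then have "nbrs L y0 = {}" by (auto simp: nbrs_def)
    then have "deg K y0 = 1" using degK[OF y0(1)] y0 by (simp add: X_def)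
    \<comment> \<open>The empty family suffices: the single vertex has weight 1 in \<open>K\<close>,
      and since \<open>L\<close> cannot contain two neighbours of \<open>x\<close> it is charged
      1.\<close>
    then show ?thesis using L by (intro exI[of _ 0]) (auto simp: fam_0 weight_def)
  next
    case True
    have pos: "deg L v \<ge> 1" if "v \<in> L" for v
      using nbrs_nonempty[OF conL that True] fL
      by (simp add: Suc_le_eq card_gt_0_iff nbrs_def)
    define H where "H = {v \<in> X. deg K v \<ge> 3}"
    have "(\<Sum>v\<in>L. weight (deg K v) + (if v \<in> H then 1 else 0)) = (\<Sum>v\<in>L. weight (deg L v))"
    proof (rule sum.cong[OF refl])
      fix v assume "v \<in> L"
      then show "weight (deg K v) + (if v \<in> H then 1 else 0) = weight (deg L v)"
        using degK[of v] weight_drop[OF pos[of v]] by (auto simp: H_def)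
    qed
    moreover have "(\<Sum>v\<in>L. if v \<in> H then 1 else 0) = int (card H)"
    proof -
      have "H \<subseteq> L" by (auto simp: H_def X_def)
      then have "L \<inter> H = H" by blast
      then show ?thesis using fL by (simp flip: sum.inter_restrict)
    qed
    ultimately have W: "(\<Sum>v\<in>L. weight (deg L v)) = ?W + int (card H)" by (simp add: sum.distrib)
    have fX: "finite X" using fL by (simp add: X_def)
    then have fH: "finite H" by (simp add: H_def)
    obtain k where k: "fam neg L k" and k': "(\<Sum>v\<in>L. weight (deg L v)) - 1 \<le> 2 * int k \<or>
      good_set L \<and> (\<Sum>v\<in>L. weight (deg L v)) - 2 \<le> 2 * int k"
      using IH[OF True] unfolding inertia_bounded_def by blast
    define e :: int where "e = ?e"
    have e01: "e = 0 \<or> e = 1" by (simp add: e_def)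
    have "?W - e \<le> 2 * int k"
    proof (cases "(\<Sum>v\<in>L. weight (deg L v)) - 1 \<le> 2 * int k")
      case True
      have "card H \<ge> 1" if "e = 0"
      proof -
        have "H \<noteq> {}" using that by (auto simp: e_def H_def X_def split: if_splits)
        then show ?thesis using fH by (simp add: Suc_le_eq card_gt_0_iff)
      qed
      then show ?thesis using True W e01 by auto
    next
      case False
      with k' have g: "good_set L" and k2: "(\<Sum>v\<in>L. weight (deg L v)) - 2 \<le> 2 * int k" by auto
      obtain vs where "set vs = L" "cyc vs" using g by (auto simp: good_set_def good_def)
      then have "deg L v = 2" if "v \<in> L" for v using deg_cyc that by metis
      then have "H = X" using degK by (auto simp: H_def X_def)
      moreover have "card X \<ge> 1"
      proof -
        have "X \<noteq> {}" using y0 by (auto simp: X_def)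
        then show ?thesis using fX by (simp add: Suc_le_eq card_gt_0_iff)
      qed
      moreover have "card X \<ge> 2" if e0: "e = 0"
      proof -
        obtain y z where "y \<in> X" "z \<in> X" "y \<noteq> z" using e0 by (auto simp: e_def X_def split: if_splits)
        then have "{y, z} \<subseteq> X" "card {y, z} = 2" by auto
        then show ?thesis using card_mono[OF fX, of "{y, z}"] by simp
      qed
      ultimately show ?thesis using W k2 e01 by auto
    qed
    with k show ?thesis unfolding e_def by blast
  qed
qed

text \<open>Every component of \<open>S\<close> contains a neighbour of \<open>x\<close>, so there
  are at most \<open>deg S x\<close> of them, each charged at most 1 by
  \<open>component_bound\<close>. Two neighbours in one component lower the number of components by
  1, and if one of them has degree at least 3 that component is charged 0. The set \<open>S\<close>
  may omit more than \<open>x\<close>, as the pendant case requires.\<close>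

lemma deletion_bound:
  assumes KV: "K \<subseteq> V" and con: "connected K" and SK: "S \<subseteq> K" and xK: "x \<in> K - S"
    and out: "\<And>y z. y \<in> S \<Longrightarrow> z \<in> K - S \<Longrightarrow> a y z \<noteq> 0 \<Longrightarrow> z = x"
    and IH: "\<And>L. L \<subseteq> S \<Longrightarrow> connected L \<Longrightarrow> card L \<ge> 2 \<Longrightarrow> inertia_bounded L"
  shows "\<exists>k. fam neg S k \<and> (\<Sum>v\<in>S. weight (deg K v)) - int (deg S x)
    + (if \<exists>y\<in>nbrs S x. \<exists>z\<in>nbrs S x. y \<noteq> z \<and> (y, z) \<in> conn S then
         (if \<exists>y\<in>nbrs S x. \<exists>z\<in>nbrs S x. y \<noteq> z \<and> (y, z) \<in> conn S \<and> deg K y \<ge> 3 then 2 else 1) else 0)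
    \<le> 2 * int k" (is "\<exists>k. _ \<and> ?W - _ + ?e \<le> _")
proof -
  have fS: "finite S" using SK KV finV by (meson finite_subset)
  define X where "X = nbrs S x"
  have X: "X \<subseteq> S" "\<And>y. y \<in> X \<longleftrightarrow> y \<in> S \<and> a y x \<noteq> 0" by (auto simp: X_def nbrs_def sym)
  have fX: "finite X" using X(1) fS by (rule finite_subset)
  \<comment> \<open>A walk in \<open>K\<close> from \<open>y\<close> to \<open>x\<close> has to
    leave the component of \<open>y\<close>, and by \<open>out\<close> it can leave only through
    \<open>x\<close>.\<close>
  have hit: "\<exists>z\<in>comp S y. a z x \<noteq> 0" if y: "y \<in> S" for y
  proof -
    have "t \<in> comp S y \<or> (\<exists>z\<in>comp S y. a z x \<noteq> 0)" if "(y, t) \<in> conn K" for t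
      using that
    proof (induction rule: conn_induct)
      case (step t u)
      show ?case
      proof (cases "t \<in> comp S y")
        case True
        then have tS: "t \<in> S" using comp_subset[OF y] by auto
        show ?thesis
        proof (cases "u \<in> S")
          case True
          then show ?thesis using step \<open>t \<in> comp S y\<close> tS by (auto intro: comp_closed)
        next
          case False
          then have "u = x" using out[OF tS] step by auto
          then show ?thesis using \<open>t \<in> comp S y\<close> step by auto
        qed
      qed (use step in auto)
    qed (simp add: comp_self)
    moreover have "(y, x) \<in> conn K" using con y SK xK by (auto simp: connected_def)
    ultimately show ?thesis using comp_subset[OF y] xK by blast
  qed
  define \<K> where "\<K> = comp S ` S"
  have \<K>: "\<K> = comp S ` X"
  proof
    show "\<K> \<subseteq> comp S ` X"
    proof
      fix L assume "L \<in> \<K>"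
      then obtain y where y: "y \<in> S" "L = comp S y" by (auto simp: \<K>_def)
      then obtain z where z: "z \<in> L" "a z x \<noteq> 0" using hit by blast
      then have "z \<in> X" using y comp_subset by (auto simp: X)
      moreover have "L = comp S z" using comp_eq z y by simp
      ultimately show "L \<in> comp S ` X" by blast
    qed
  qed (use X(1) in \<open>auto simp: \<K>_def\<close>)
  have f\<K>: "finite \<K>" using fS by (simp add: \<K>_def)
  \<comment> \<open>The charge of a component, as in \<open>component_bound\<close>.\<close>
  define c :: "'a set \<Rightarrow> int" where "c L = (if \<exists>y\<in>L. \<exists>z\<in>L. y \<noteq> z \<and> a y x \<noteq> 0 \<and> a z x \<noteq> 0 \<and> deg K y \<ge> 3 then 0 else 1)" for L
  have "\<exists>k. fam neg L k \<and> (\<Sum>v\<in>L. weight (deg K v)) - c L \<le> 2 * int k" if L: "L \<in> \<K>" for L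
  proof -
    obtain y where y: "y \<in> S" "L = comp S y" using L by (auto simp: \<K>_def)
    have LS: "L \<subseteq> S" using comp_subset y by simp
    have conL: "connected L" using connected_comp y by simp
    show ?thesis unfolding c_def
    proof (rule component_bound[OF KV _ _ conL])
      show "z = x" if "u \<in> L" "z \<in> K - L" "a u z \<noteq> 0" for u z
      proof (cases "z \<in> S")
        case True
        then show ?thesis using comp_closed[of u S y z] that y LS by auto
      next
        case False
        then show ?thesis using out that LS by auto
      qed
    qed (use LS SK xK hit y IH[OF LS conL] in auto)
  qed
  then obtain k where k: "\<And>L. L \<in> \<K> \<Longrightarrow> fam neg L (k L)"
    "\<And>L. L \<in> \<K> \<Longrightarrow> (\<Sum>v\<in>L. weight (deg K v)) - c L \<le> 2 * int (k L)" by metis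
  have "fam neg (\<Union>\<K>) (\<Sum>L\<in>\<K>. k L)"
    using f\<K> k(1) pairwise_separated_comps unfolding \<K>_def by (intro fam_neg_Union) auto
  then have fam: "fam neg S (\<Sum>L\<in>\<K>. k L)" by (simp add: \<K>_def Union_comps)
  have "(\<Sum>L\<in>\<K>. \<Sum>v\<in>L. weight (deg K v)) = ?W"
    unfolding \<K>_def by (rule sum_over_comps[OF fS, symmetric])
  moreover have "(\<Sum>L\<in>\<K>. (\<Sum>v\<in>L. weight (deg K v)) - c L) \<le> (\<Sum>L\<in>\<K>. 2 * int (k L))"
    using k(2) by (rule sum_mono)
  ultimately have main: "?W - (\<Sum>L\<in>\<K>. c L) \<le> 2 * int (\<Sum>L\<in>\<K>. k L)"
    by (simp add: sum_subtractf sum_distrib_left)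
  have c1: "c L \<le> 1" for L by (simp add: c_def)
  have cK: "(\<Sum>L\<in>\<K>. c L) \<le> int (card \<K>)" using sum_mono[of \<K> c "\<lambda>_. 1"] c1 by simp
  have "(\<Sum>L\<in>\<K>. c L) \<le> int (card X) - ?e"
  proof -
    have card1: "card \<K> \<le> card X" unfolding \<K> by (rule card_image_le[OF fX])
    have card2: "int (card \<K>) \<le> int (card X) - 1"
      if yz: "y \<in> X" "z \<in> X" "y \<noteq> z" "(y, z) \<in> conn S" for y z
    proof -
      have "comp S z = comp S y" using yz by (intro comp_eq) (simp add: comp_def)
      then have "\<K> = comp S ` (X - {z})" unfolding \<K> using yz by auto
      then have "card \<K> \<le> card (X - {z})" using card_image_le[of "X - {z}" "comp S"] fX by simp
      moreover have "card X > 0" using yz fX by (auto simp: card_gt_0_iff)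
      ultimately show ?thesis using yz fX by (simp add: of_nat_diff)
    qed
    have card3: "(\<Sum>L\<in>\<K>. c L) \<le> int (card X) - 2"
      if yz: "y \<in> X" "z \<in> X" "y \<noteq> z" "(y, z) \<in> conn S" "deg K y \<ge> 3" for y z
    proof -
      define L where "L = comp S y"
      have L: "L \<in> \<K>" using yz by (auto simp: \<K> L_def)
      have "y \<in> L" "z \<in> L" using yz(4) by (auto simp: L_def comp_def)
      then have "\<exists>y\<in>L. \<exists>z\<in>L. y \<noteq> z \<and> a y x \<noteq> 0 \<and> a z x \<noteq> 0 \<and> deg K y \<ge> 3"
        using yz X(2) by blast
      then have "c L = 0" by (simp add: c_def)
      then have "(\<Sum>L\<in>\<K>. c L) = (\<Sum>L\<in>\<K> - {L}. c L)" using f\<K> L by (simp add: sum.remove)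
      also have "\<dots> \<le> int (card (\<K> - {L}))" using sum_mono[of "\<K> - {L}" c "\<lambda>_. 1"] c1 by simp
      also have "\<dots> = int (card \<K>) - 1"
        using f\<K> L card_Suc_Diff1[OF f\<K> L] by linarith
      finally show ?thesis using card2[OF yz(1-4)] by simp
    qed
    show ?thesis unfolding X_def[symmetric]
    proof (cases "\<exists>y\<in>X. \<exists>z\<in>X. y \<noteq> z \<and> (y, z) \<in> conn S \<and> deg K y \<ge> 3")
      case True
      then have ex: "\<exists>y\<in>X. \<exists>z\<in>X. y \<noteq> z \<and> (y, z) \<in> conn S" by blast
      from True obtain y z where "y \<in> X" "z \<in> X" "y \<noteq> z" "(y, z) \<in> conn S" "deg K y \<ge> 3" by blast
      from card3[OF this] show "(\<Sum>L\<in>\<K>. c L) \<le> int (card X) - (if \<exists>y\<in>X. \<exists>z\<in>X. y \<noteq> z \<and> (y, z) \<in> conn S then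
         (if \<exists>y\<in>X. \<exists>z\<in>X. y \<noteq> z \<and> (y, z) \<in> conn S \<and> deg K y \<ge> 3 then 2 else 1) else 0)"
        by (simp only: if_P[OF True] if_P[OF ex])
    next
      case F: False
      show "(\<Sum>L\<in>\<K>. c L) \<le> int (card X) - (if \<exists>y\<in>X. \<exists>z\<in>X. y \<noteq> z \<and> (y, z) \<in> conn S then
         (if \<exists>y\<in>X. \<exists>z\<in>X. y \<noteq> z \<and> (y, z) \<in> conn S \<and> deg K y \<ge> 3 then 2 else 1) else 0)"
      proof (cases "\<exists>y\<in>X. \<exists>z\<in>X. y \<noteq> z \<and> (y, z) \<in> conn S")
        case True
        then obtain y z where "y \<in> X" "z \<in> X" "y \<noteq> z" "(y, z) \<in> conn S" by blast
        from card2[OF this] cK show ?thesis by (simp only: if_not_P[OF F] if_P[OF True])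
      next
        case False
        then show ?thesis using card1 cK by (simp only: if_not_P) simp
      qed
    qed
  qed
  with main fam show ?thesis unfolding X_def[symmetric] by (intro exI[of _ "\<Sum>L\<in>\<K>. k L"]) linarith
qed

lemma nbrs_delete_self: "nbrs (K - {x}) x = nbrs K x"
  by (auto simp: nbrs_def)

lemma finite_nbrs: "K \<subseteq> V \<Longrightarrow> finite (nbrs K v)"
  by (rule finite_subset[OF _ finV]) (auto simp: nbrs_def)

text \<open>The weight 3 - d of the deleted vertex meets a charge of at most d - 1 for the rest, or
  d - 2 if \<open>y\<close> has degree at least 3; the totals are 2 and 1. The family on the rest
  serves for \<open>K\<close> unchanged.\<close>

lemma delete_cycle_vertex:
  assumes KV: "K \<subseteq> V" and con: "connected K" and x: "x \<in> K"
    and yz: "y \<in> nbrs K x" "z \<in> nbrs K x" "y \<noteq> z" "(y, z) \<in> conn (K - {x})"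
    and IH: "\<And>L. L \<subseteq> K - {x} \<Longrightarrow> connected L \<Longrightarrow> card L \<ge> 2 \<Longrightarrow> inertia_bounded L"
  shows "\<exists>k. fam neg K k \<and> (\<Sum>v\<in>K. weight (deg K v)) - 2 + (if deg K y \<ge> 3 then 1 else 0) \<le> 2 * int k"
proof -
  define S where "S = K - {x}"
  have nb: "nbrs S x = nbrs K x" by (simp add: S_def nbrs_delete_self)
  have ex: "\<exists>y\<in>nbrs S x. \<exists>z\<in>nbrs S x. y \<noteq> z \<and> (y, z) \<in> conn S"
    using yz nb by (auto simp: S_def)
  have "\<exists>k. fam neg S k \<and> (\<Sum>v\<in>S. weight (deg K v)) - int (deg S x)
    + (if \<exists>y\<in>nbrs S x. \<exists>z\<in>nbrs S x. y \<noteq> z \<and> (y, z) \<in> conn S then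
         (if \<exists>y\<in>nbrs S x. \<exists>z\<in>nbrs S x. y \<noteq> z \<and> (y, z) \<in> conn S \<and> deg K y \<ge> 3 then 2 else 1) else 0)
    \<le> 2 * int k"
    by (rule deletion_bound[OF KV con]) (use x IH in \<open>auto simp: S_def\<close>)
  then obtain k where k: "fam neg S k" "(\<Sum>v\<in>S. weight (deg K v)) - int (deg S x)
    + (if \<exists>y\<in>nbrs S x. \<exists>z\<in>nbrs S x. y \<noteq> z \<and> (y, z) \<in> conn S \<and> deg K y \<ge> 3 then 2 else 1) \<le> 2 * int k"
    unfolding if_P[OF ex] by blast
  have ge: "(if deg K y \<ge> 3 then 2 else 1)
      \<le> (if \<exists>y\<in>nbrs S x. \<exists>z\<in>nbrs S x. y \<noteq> z \<and> (y, z) \<in> conn S \<and> deg K y \<ge> 3 then 2 else (1::int))"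
    using yz nb by (auto simp: S_def)
  have fK: "finite K" using KV finV by (rule finite_subset)
  have "{y, z} \<subseteq> nbrs K x" using yz by auto
  from card_mono[OF finite_nbrs[OF KV] this] have d: "deg K x \<ge> 2" using yz by simp
  have "(\<Sum>v\<in>K. weight (deg K v)) = weight (deg K x) + (\<Sum>v\<in>S. weight (deg K v))"
    using fK x by (simp add: S_def sum.remove)
  also have "weight (deg K x) = 3 - int (deg K x)" using d by (simp add: weight_def)
  finally have "(\<Sum>v\<in>K. weight (deg K v)) - 2 + (if deg K y \<ge> 3 then 1 else 0) \<le> 2 * int k"
    using k(2) ge unfolding nb by (auto split: if_splits)
  moreover have "fam neg K k" using k(1) by (rule fam_mono) (auto simp: S_def)
  ultimately show ?thesis by blast
qed

text \<open>Both ends of the pendant edge are deleted. Their weights and the charge of the rest add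
  up to at most 3, while the edge supplies one more dimension by
  \<open>fam_neg_pendant\<close>.\<close>

lemma bounded_pendant:
  assumes KV: "K \<subseteq> V" and con: "connected K" and u: "u \<in> K" and v: "nbrs K u = {v}"
    and IH: "\<And>L. L \<subset> K \<Longrightarrow> connected L \<Longrightarrow> card L \<ge> 2 \<Longrightarrow> inertia_bounded L"
  shows "inertia_bounded K"
proof -
  define S where "S = K - {u, v}"
  have vK: "v \<in> K" and uv: "a u v \<noteq> 0" using v by (auto simp: nbrs_def)
  have ne: "u \<noteq> v" using uv by auto
  have nu: "a u w = 0" if "w \<in> K" "w \<noteq> v" for w using v that by (auto simp: nbrs_def)
  have "\<exists>k. fam neg S k \<and> (\<Sum>v\<in>S. weight (deg K v)) - int (deg S v)
    + (if \<exists>y\<in>nbrs S v. \<exists>z\<in>nbrs S v. y \<noteq> z \<and> (y, z) \<in> conn S then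
         (if \<exists>y\<in>nbrs S v. \<exists>z\<in>nbrs S v. y \<noteq> z \<and> (y, z) \<in> conn S \<and> deg K y \<ge> 3 then 2 else 1) else 0)
    \<le> 2 * int k" (is "\<exists>k. _ \<and> _ + ?e \<le> _")
  proof (rule deletion_bound[OF KV con])
    show "S \<subseteq> K" "v \<in> K - S" using vK by (auto simp: S_def)
    show "z = v" if "y \<in> S" "z \<in> K - S" "a y z \<noteq> 0" for y z
      using that nu[of y] sym[of y u] by (auto simp: S_def)
    show "inertia_bounded L" if "L \<subseteq> S" "connected L" "card L \<ge> 2" for L
      using that u by (intro IH) (auto simp: S_def)
  qed
  moreover have "?e \<ge> 0" by simp
  ultimately obtain k where k: "fam neg S k" "(\<Sum>v\<in>S. weight (deg K v)) - int (deg S v) \<le> 2 * int k"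
    by (smt (verit, best))
  have "fam neg (insert u (insert v S)) (Suc k)"
    by (rule fam_neg_pendant[OF k(1)]) (use u vK KV uv nu in \<open>auto simp: S_def\<close>)
  moreover have "insert u (insert v S) = K" using u vK by (auto simp: S_def)
  ultimately have fam: "fam neg K (Suc k)" by simp
  have fK: "finite K" using KV finV by (rule finite_subset)
  have "nbrs K v = insert u (nbrs S v)" "u \<notin> nbrs S v"
    using u uv sym[of u v] ne by (auto simp: nbrs_def S_def)
  then have dv: "deg K v = Suc (deg S v)"
    using finite_nbrs[of S v] KV by (simp add: S_def subset_iff)
  have "(\<Sum>v\<in>K. weight (deg K v)) = weight (deg K u) + (weight (deg K v) + (\<Sum>v\<in>S. weight (deg K v)))"
    using fK u vK ne by (simp add: S_def sum.remove[of K u] sum.remove[of "K - {u}" v] insert_Diff_if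
      Diff_insert[symmetric] insert_commute)
  also have "weight (deg K u) = 1" using v by (simp add: weight_def)
  \<comment> \<open>This is an equality unless \<open>v\<close> is pendant too, when it reads 1
    \<le> 2.\<close>
  also have "weight (deg K v) \<le> 2 - int (deg S v)" using dv by (auto simp: weight_def)
  finally have "(\<Sum>v\<in>K. weight (deg K v)) - 1 \<le> 2 * int (Suc k)" using k(2) by simp
  with fam show ?thesis unfolding inertia_bounded_def by blast
qed

section \<open>Longest paths, branching graphs and cycles\<close>

definition path :: "'a set \<Rightarrow> 'a list \<Rightarrow> bool" where
  "path K xs \<longleftrightarrow> xs \<noteq> [] \<and> distinct xs \<and> set xs \<subseteq> K \<and>
     (\<forall>j. Suc j < length xs \<longrightarrow> a (xs ! j) (xs ! Suc j) \<noteq> 0)"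

lemma path_snoc:
  assumes "path K xs" "w \<in> nbrs K (last xs)" "w \<notin> set xs"
  shows "path K (xs @ [w])"
proof -
  have ne: "xs \<noteq> []" using assms(1) by (simp add: path_def)
  have "a ((xs @ [w]) ! j) ((xs @ [w]) ! Suc j) \<noteq> 0" if "Suc j < length (xs @ [w])" for j
  proof (cases "Suc j = length xs")
    case True
    then have "(xs @ [w]) ! j = last xs" using ne by (simp add: nth_append last_conv_nth flip: True)
    then show ?thesis using assms(2) True by (simp add: nbrs_def nth_append)
  next
    case False
    then show ?thesis using assms(1) that by (simp add: path_def nth_append)
  qed
  then show ?thesis using assms by (auto simp: path_def nbrs_def)
qed

lemma path_conn:
  assumes "path K xs" "j < length xs" "i \<le> j" "\<And>k. i \<le> k \<Longrightarrow> k \<le> j \<Longrightarrow> xs ! k \<in> T"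
  shows "(xs ! i, xs ! j) \<in> conn T"
  using assms(3,2,4)
proof (induction j rule: dec_induct)
  case (step j)
  have "(xs ! i, xs ! j) \<in> conn T" using step by auto
  moreover have "(xs ! j, xs ! Suc j) \<in> conn T"
    using step assms(1) by (intro conn_step) (auto simp: path_def)
  ultimately show ?case by (rule conn_trans)
qed simp

text \<open>On a longest path from \<open>r\<close> all neighbours of the last vertex lie on the
  path. By the degree bound one of them is not its predecessor and therefore closes a cycle. The
  start is prescribed because \<open>r\<close> will be the branching vertex.\<close>

lemma long_path:
  assumes fK: "finite K" and r: "r \<in> K" and deg: "\<And>v. v \<in> K \<Longrightarrow> deg K v \<ge> 2"
  obtains xs i where "path K xs" "xs ! 0 = r" "i + 2 < length xs" "a (last xs) (xs ! i) \<noteq> 0"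
    "nbrs K (last xs) \<subseteq> set xs"
proof -
  have "length xs < Suc (card K)" if "path K xs" for xs
    using that card_mono[OF fK, of "set xs"] by (auto simp: path_def distinct_card)
  then have "\<exists>xs. (path K xs \<and> xs ! 0 = r) \<and> (\<forall>ys. path K ys \<and> ys ! 0 = r \<longrightarrow> length ys \<le> length xs)"
    using r by (intro ex_has_greatest_nat[where k = "[r]" and b = "Suc (card K)"]) (auto simp: path_def)
  then obtain xs where xs: "path K xs" "xs ! 0 = r"
    and max: "\<And>ys. path K ys \<Longrightarrow> ys ! 0 = r \<Longrightarrow> length ys \<le> length xs" by blast
  have ne: "xs \<noteq> []" using xs by (simp add: path_def)
  have sub: "nbrs K (last xs) \<subseteq> set xs"
  proof
    fix w assume w: "w \<in> nbrs K (last xs)"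
    show "w \<in> set xs"
    proof (rule ccontr)
      assume "w \<notin> set xs"
      from max[OF path_snoc[OF xs(1) w this]] xs(2) ne show False by (simp add: nth_append)
    qed
  qed
  have "last xs \<in> K" using xs ne by (auto simp: path_def)
  then have "deg K (last xs) \<ge> 2" by (rule deg)
  then have "\<not> nbrs K (last xs) \<subseteq> {xs ! (length xs - 2)}"
    using card_mono[of "{xs ! (length xs - 2)}" "nbrs K (last xs)"] by auto
  then obtain w where w: "w \<in> nbrs K (last xs)" "w \<noteq> xs ! (length xs - 2)" by blast
  then obtain i where i: "i < length xs" "w = xs ! i" using sub by (metis in_set_conv_nth subsetD)
  have "i \<noteq> length xs - 1"
  proof
    assume "i = length xs - 1"
    then have "w = last xs" using i ne by (simp add: last_conv_nth)
    then show False using w by (simp add: nbrs_def)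
  qed
  moreover have "i \<noteq> length xs - 2" using w i by auto
  ultimately have "i + 2 < length xs" using i by linarith
  then show thesis using that[OF xs _ _ sub] w i by (auto simp: nbrs_def)
qed

text \<open>The predecessor, the successor and the last vertex of the path are three distinct
  neighbours.\<close>

lemma path_inner_degree:
  assumes KV: "K \<subseteq> V" and p: "path K xs" and i: "i + 2 < length xs" "i > 0"
    and l: "a (last xs) (xs ! i) \<noteq> 0"
  shows "deg K (xs ! i) \<ge> 3"
proof -
  have d: "distinct xs" and s: "set xs \<subseteq> K" and ne: "xs \<noteq> []" using p by (auto simp: path_def)
  have "a (xs ! (i - 1)) (xs ! i) \<noteq> 0" "a (xs ! i) (xs ! Suc i) \<noteq> 0"
    using p i unfolding path_def by (metis One_nat_def Suc_lessD Suc_pred add_2_eq_Suc', metis Suc_lessD add_2_eq_Suc')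
  then have "{xs ! (i - 1), xs ! Suc i, xs ! (length xs - 1)} \<subseteq> nbrs K (xs ! i)"
    using i l s sym[of "xs ! (i - 1)"] sym[of "last xs"] ne by (auto simp: nbrs_def last_conv_nth)
  from card_mono[OF finite_nbrs[OF KV] this] show ?thesis
    using d i by (auto simp: nth_eq_iff_index_eq card_insert_if split: if_splits)
qed

text \<open>The vertex deleted is the end of a longest path from \<open>r\<close>; its neighbour
  \<open>xs ! i\<close> and its predecessor remain joined by the path between them.\<close>

lemma bounded_branching:
  assumes KV: "K \<subseteq> V" and con: "connected K" and deg: "\<And>v. v \<in> K \<Longrightarrow> deg K v \<ge> 2"
    and r: "r \<in> K" "deg K r \<ge> 3"
    and IH: "\<And>L. L \<subset> K \<Longrightarrow> connected L \<Longrightarrow> card L \<ge> 2 \<Longrightarrow> inertia_bounded L"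
  shows "inertia_bounded K"
proof -
  have fK: "finite K" using KV finV by (rule finite_subset)
  obtain xs i where p: "path K xs" "xs ! 0 = r" and i: "i + 2 < length xs" "a (last xs) (xs ! i) \<noteq> 0"
    by (rule long_path[OF fK r(1)], erule deg, rule that; assumption)
  have d: "distinct xs" and s: "set xs \<subseteq> K" using p by (auto simp: path_def)
  define m where "m = length xs - 1"
  have m: "last xs = xs ! m" "Suc m = length xs"
    using i p(1) by (auto simp: m_def last_conv_nth path_def)
  \<comment> \<open>The cycle closes either at an inner vertex of the path or at its start
    \<open>r\<close>, and both branch.\<close>
  have y: "deg K (xs ! i) \<ge> 3"
    using path_inner_degree[OF KV p(1) i(1) _ i(2)] r p(2) by (cases "i = 0") auto
  have m1: "Suc (m - 1) = m" using i m by simp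
  then have "Suc (m - 1) < length xs" using m by simp
  then have z: "a (xs ! (m - 1)) (xs ! m) \<noteq> 0" using p(1) by (metis m1 path_def)
  have "\<exists>k. fam neg K k \<and> (\<Sum>v\<in>K. weight (deg K v)) - 2 + (if deg K (xs ! i) \<ge> 3 then 1 else 0) \<le> 2 * int k"
  proof (rule delete_cycle_vertex[OF KV con, of "xs ! m" "xs ! i" "xs ! (m - 1)"])
    show mK: "xs ! m \<in> K" using s m by auto
    show "xs ! i \<in> nbrs K (xs ! m)" "xs ! (m - 1) \<in> nbrs K (xs ! m)"
      using s i m z sym[of "xs ! m"] by (auto simp: nbrs_def)
    show "xs ! i \<noteq> xs ! (m - 1)" using d i m by (simp add: nth_eq_iff_index_eq)
    show "(xs ! i, xs ! (m - 1)) \<in> conn (K - {xs ! m})"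
      using s i m d by (intro path_conn[OF p(1)]) (auto simp: nth_eq_iff_index_eq)
    show "inertia_bounded L" if "L \<subseteq> K - {xs ! m}" "connected L" "card L \<ge> 2" for L
      using that mK by (intro IH) auto
  qed
  then show ?thesis using y unfolding inertia_bounded_def by auto
qed

lemma connected_closed_subset:
  assumes "connected K" "W \<subseteq> K" "W \<noteq> {}" "\<And>v. v \<in> W \<Longrightarrow> nbrs K v \<subseteq> W"
  shows "W = K"
proof
  show "K \<subseteq> W"
  proof
    fix y assume y: "y \<in> K"
    obtain x where x: "x \<in> W" using assms(3) by blast
    then have "(x, y) \<in> conn K" using assms y by (auto simp: connected_def)
    then show "y \<in> W"
      by (induction rule: conn_induct) (use x assms(4) in \<open>auto simp: nbrs_def\<close>)
  qed
qed fact

text \<open>A longest path must close up at its start, since closing at an inner vertex would give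
  degree 3. Its vertex set is then closed under neighbours, so connectedness makes it all of
  \<open>K\<close>.\<close>

lemma two_regular_cycle:
  assumes KV: "K \<subseteq> V" and con: "connected K" and deg: "\<And>v. v \<in> K \<Longrightarrow> deg K v = 2" and r: "r \<in> K"
  shows "\<exists>vs. set vs = K \<and> cyc vs"
proof -
  have fK: "finite K" using KV finV by (rule finite_subset)
  obtain xs i where p: "path K xs" "xs ! 0 = r" and i: "i + 2 < length xs" "a (last xs) (xs ! i) \<noteq> 0"
    by (rule long_path[OF fK r], simp add: deg, rule that; assumption)
  have d: "distinct xs" and s: "set xs \<subseteq> K" using p by (auto simp: path_def)
  define m where "m = length xs"
  have m: "m \<ge> 3" using i by (simp add: m_def)
  have "i = 0"
  proof (rule ccontr)
    assume "i \<noteq> 0"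
    then have "deg K (xs ! i) \<ge> 3" using path_inner_degree[OF KV p(1) i(1) _ i(2)] by simp
    moreover have "xs ! i \<in> K" using s i by auto
    ultimately show False using deg by simp
  qed
  then have close: "a (xs ! (m - 1)) (xs ! 0) \<noteq> 0" using i p(1) by (simp add: last_conv_nth m_def path_def)
  have next': "a (xs ! j) (xs ! (Suc j mod m)) \<noteq> 0" if "j < m" for j
  proof (cases "Suc j = m")
    case True
    then have "j = m - 1" by simp
    then show ?thesis using close m by simp
  next
    case False
    then have "Suc j < m" using that by simp
    then show ?thesis using p(1) by (simp add: path_def m_def)
  qed
  \<comment> \<open>The successor and the predecessor \<open>l\<close> are distinct neighbours of
    \<open>j\<close>, so degree 2 leaves no room for a chord.\<close>
  have nb: "nbrs K (xs ! j) = {xs ! (Suc j mod m), xs ! l}" if j: "j < m" and l: "l < m" "Suc l mod m = j" for j l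
  proof -
    have "a (xs ! l) (xs ! j) \<noteq> 0" using next'[OF l(1)] l(2) by simp
    moreover have md: "Suc j mod m < m" using m by simp
    then have "xs ! (Suc j mod m) \<in> K" "xs ! l \<in> K"
      using s l nth_mem unfolding m_def by blast+
    ultimately have sub: "{xs ! (Suc j mod m), xs ! l} \<subseteq> nbrs K (xs ! j)"
      using next'[OF j] sym[of "xs ! l"] by (auto simp: nbrs_def)
    have "l \<noteq> Suc j mod m" using j l m by (auto simp: Suc_mod_eq split: if_splits)
    then have "xs ! (Suc j mod m) \<noteq> xs ! l"
      using nth_eq_iff_index_eq[OF d md[unfolded m_def] l(1)[unfolded m_def]] by (simp add: m_def)
    then have "card {xs ! (Suc j mod m), xs ! l} = 2" by simp
    moreover have "xs ! j \<in> K" using s j nth_mem unfolding m_def by blast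
    then have "deg K (xs ! j) = 2" by (rule deg)
    ultimately show ?thesis using card_subset_eq[OF finite_nbrs[OF KV] sub] by simp
  qed
  have pred: "\<exists>l<m. Suc l mod m = j" if "j < m" for j
    using that m by (intro exI[of _ "if j = 0 then m - 1 else j - 1"]) auto
  have K: "set xs = K"
  proof (rule connected_closed_subset[OF con s])
    fix v assume "v \<in> set xs"
    then obtain j where j: "j < m" "v = xs ! j" by (auto simp: in_set_conv_nth m_def)
    obtain l where "l < m" "Suc l mod m = j" using pred[OF j(1)] by blast
    moreover have "Suc j mod m < m" using m by simp
    ultimately show "nbrs K v \<subseteq> set xs"
      using nb[OF j(1)] nth_mem[of _ xs] unfolding j(2) m_def by (metis empty_subsetI insert_subset)
  qed (use p in \<open>auto simp: path_def\<close>)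
  have "cyc xs" unfolding cyc_def
  proof (intro conjI allI impI)
    fix j t assume "j < length xs" "t < length xs"
    then have jt: "j < m" "t < m" by (auto simp: m_def)
    obtain l where l: "l < m" "Suc l mod m = j" using pred[OF jt(1)] by blast
    have "a (xs ! j) (xs ! t) \<noteq> 0 \<longleftrightarrow> xs ! t \<in> nbrs K (xs ! j)"
      using s jt by (auto simp: nbrs_def m_def)
    also have "\<dots> \<longleftrightarrow> xs ! t = xs ! (Suc j mod m) \<or> xs ! t = xs ! l"
      unfolding nb[OF jt(1) l] by simp
    also have "\<dots> \<longleftrightarrow> t = Suc j mod m \<or> t = l"
    proof -
      have "Suc j mod m < m" using m by simp
      then show ?thesis
        using nth_eq_iff_index_eq[OF d, of t "Suc j mod m"] nth_eq_iff_index_eq[OF d, of t l] jt l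
        by (simp add: m_def)
    qed
    also have "t = l \<longleftrightarrow> j = Suc t mod m"
      using jt l by (auto simp: Suc_mod_eq split: if_splits)
    finally show "(a (xs ! j) (xs ! t) \<noteq> 0) = (t = Suc j mod length xs \<or> j = Suc t mod length xs)"
      by (simp add: m_def)
  qed (use d m in \<open>auto simp: m_def\<close>)
  with K show ?thesis by blast
qed

lemma cyc_step:
  assumes "cyc vs" "j < length vs"
  shows "a (vs ! j) (vs ! (Suc j mod length vs)) \<noteq> 0"
proof -
  have "Suc j mod length vs < length vs" using assms by (intro mod_less_divisor) auto
  then show ?thesis using assms unfolding cyc_def by blast
qed

lemma cyc_path:
  assumes "cyc vs"
  shows "path (set vs) vs"
proof -
  have "a (vs ! j) (vs ! Suc j) \<noteq> 0" if "Suc j < length vs" for j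
    using cyc_step[OF assms, of j] that by simp
  then show ?thesis using assms by (auto simp: path_def cyc_def)
qed

text \<open>All weights are 1 and add up to the length. Deleting a vertex gives charge 2, which is
  what a good cycle may cost; the other even cycles are covered by
  \<open>fam_neg_even_cycle\<close>.\<close>

lemma bounded_cycle:
  assumes KV: "K \<subseteq> V" and con: "connected K" and vs: "set vs = K" "cyc vs"
    and IH: "\<And>L. L \<subset> K \<Longrightarrow> connected L \<Longrightarrow> card L \<ge> 2 \<Longrightarrow> inertia_bounded L"
  shows "inertia_bounded K"
proof -
  define m where "m = length vs"
  have m: "m \<ge> 3" "distinct vs" using vs by (auto simp: cyc_def m_def)
  have W: "(\<Sum>v\<in>K. weight (deg K v)) = int m"
  proof -
    have "(\<Sum>v\<in>K. weight (deg K v)) = (\<Sum>v\<in>K. 1)"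
      using deg_cyc[OF vs(2)] vs(1) by (intro sum.cong) (auto simp: weight_def)
    then show ?thesis using m vs(1) by (simp add: m_def distinct_card[symmetric])
  qed
  have step: "a (vs ! j) (vs ! (Suc j mod m)) \<noteq> 0" if "j < m" for j
    using cyc_step[OF vs(2)] that by (simp add: m_def)
  have e1: "a (vs ! (m - 1)) (vs ! 0) \<noteq> 0" using step[of "m - 1"] m by simp
  have e2: "a (vs ! (m - 2)) (vs ! (m - 1)) \<noteq> 0"
  proof -
    have "Suc (m - 2) mod m = m - 1" using m by (simp add: Suc_mod_eq)
    then show ?thesis using step[of "m - 2"] m by simp
  qed
  have p: "path K vs" using cyc_path[OF vs(2)] vs(1) by simp
  \<comment> \<open>Deleting the vertex of last index leaves an initial segment of the list, which
    is visibly a path.\<close>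
  have "\<exists>k. fam neg K k \<and> (\<Sum>v\<in>K. weight (deg K v)) - 2 + (if deg K (vs ! 0) \<ge> 3 then 1 else 0) \<le> 2 * int k"
  proof (rule delete_cycle_vertex[OF KV con, of "vs ! (m - 1)" "vs ! 0" "vs ! (m - 2)"])
    show mK: "vs ! (m - 1) \<in> K" using vs m by (auto simp: m_def)
    have "vs ! j \<in> K" if "j < m" for j using that vs(1) nth_mem unfolding m_def by blast
    from this[of 0] this[of "m - 2"]
    show "vs ! 0 \<in> nbrs K (vs ! (m - 1))" "vs ! (m - 2) \<in> nbrs K (vs ! (m - 1))"
      using m e1 e2 sym[of "vs ! (m - 2)"] by (auto simp: nbrs_def)
    have "vs ! 0 = vs ! (m - 2) \<longleftrightarrow> 0 = m - 2"
      by (rule nth_eq_iff_index_eq[OF m(2)]) (use m(1) in \<open>auto simp: m_def\<close>)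
    then show "vs ! 0 \<noteq> vs ! (m - 2)" using m(1) by simp
    show "(vs ! 0, vs ! (m - 2)) \<in> conn (K - {vs ! (m - 1)})"
      using vs m by (intro path_conn[OF p]) (auto simp: nth_eq_iff_index_eq m_def)
    show "inertia_bounded L" if "L \<subseteq> K - {vs ! (m - 1)}" "connected L" "card L \<ge> 2" for L
      using that mK by (intro IH) auto
  qed
  then obtain k where k: "fam neg K k" "int m - 2 \<le> 2 * int k" unfolding W by (auto split: if_splits)
  show ?thesis
  proof (cases "good vs")
    case True
    then show ?thesis using k vs(1) unfolding inertia_bounded_def W good_set_def by blast
  next
    case bad: False
    show ?thesis
    proof (cases "even m")
      case True
      have "fam neg K (m div 2)"
        using fam_neg_even_cycle[OF vs(2)] vs(1) KV True bad by (simp add: m_def)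
      moreover have "int m - 1 \<le> 2 * int (m div 2)" using True by auto
      ultimately show ?thesis unfolding inertia_bounded_def W by blast
    next
      case False
      \<comment> \<open>For odd m the number m - 2 is odd and the even number 2k exceeds it.\<close>
      then have "int m - 1 \<le> 2 * int k" using k(2) by presburger
      with k(1) show ?thesis unfolding inertia_bounded_def W by blast
    qed
  qed
qed

theorem bounded_connected:
  assumes "K \<subseteq> V" "connected K" "card K \<ge> 2"
  shows "inertia_bounded K"
proof -
  have "finite K" using assms(1) finV by (rule finite_subset)
  then show ?thesis using assms
  proof (induction K rule: finite_psubset_induct)
    case (psubset K)
    note KV = psubset.prems(1) and con = psubset.prems(2)
    have IH: "inertia_bounded L" if "L \<subset> K" "connected L" "card L \<ge> 2" for L
      using psubset.IH[OF that(1) _ that(2,3)] that(1) KV by blast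
    have pos: "deg K v \<ge> 1" if "v \<in> K" for v
      using nbrs_nonempty[OF con that psubset.prems(3)] finite_nbrs[OF KV]
      by (simp add: Suc_le_eq card_gt_0_iff)
    have "K \<noteq> {}" using psubset.prems(3) by auto
    then obtain r where r: "r \<in> K" by blast
    consider u where "u \<in> K" "deg K u = 1" | u where "\<And>v. v \<in> K \<Longrightarrow> deg K v \<ge> 2" "u \<in> K" "deg K u \<ge> 3"
      | "\<And>v. v \<in> K \<Longrightarrow> deg K v = 2"
      using pos by (metis One_nat_def Suc_1 Suc_leI le_neq_implies_less numeral_3_eq_3)
    then show ?case
    proof cases
      case (1 u)
      then obtain v where "nbrs K u = {v}" by (auto simp: card_1_singleton_iff)
      then show ?thesis using bounded_pendant[OF KV con 1(1)] IH by blast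
    next
      case (2 u)
      then show ?thesis using bounded_branching[OF KV con] IH by blast
    next
      case 3
      then obtain vs where "set vs = K" "cyc vs" using two_regular_cycle[OF KV con _ r] by blast
      then show ?thesis using bounded_cycle[OF KV con] IH by blast
    qed
  qed
qed

section \<open>From connected graphs to all components\<close>

lemma connected_cyc:
  assumes "cyc vs"
  shows "connected (set vs)"
proof -
  have "(vs ! 0, v) \<in> conn (set vs)" if "v \<in> set vs" for v
  proof -
    obtain j where "j < length vs" "v = vs ! j" using \<open>v \<in> set vs\<close> by (auto simp: in_set_conv_nth)
    then show ?thesis using path_conn[OF cyc_path[OF assms], of j 0 "set vs"] by simp
  qed
  then show ?thesis unfolding connected_def by (blast intro: conn_trans conn_sym)
qed

lemma conn_mono: "S \<subseteq> T \<Longrightarrow> conn S \<subseteq> conn T"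
  unfolding conn_def by (rule rtrancl_mono) auto

lemma comp_eq_closed:
  assumes "connected W" "W \<subseteq> S" "x \<in> W" "\<And>v. v \<in> W \<Longrightarrow> nbrs S v \<subseteq> W"
  shows "comp S x = W"
proof
  show "W \<subseteq> comp S x"
    using assms conn_mono[OF assms(2)] unfolding comp_def connected_def by blast
  show "comp S x \<subseteq> W"
  proof
    fix y assume "y \<in> comp S x"
    then have "(x, y) \<in> conn S" by (simp add: comp_def)
    then show "y \<in> W"
      by (induction rule: conn_induct) (use assms(3,4) in \<open>auto simp: nbrs_def\<close>)
  qed
qed

lemma nbrs_comp: "x \<in> S \<Longrightarrow> v \<in> comp S x \<Longrightarrow> nbrs (comp S x) v = nbrs S v"
  using comp_subset comp_closed unfolding nbrs_def by blast

text \<open>Each component is charged 2 and gets 1 back unless it is good, so the surplus over the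
  extremal value counts the components that are not good.\<close>

lemma fam_neg_lower_bound:
  assumes two: "\<And>K. K \<in> comp V ` V \<Longrightarrow> card K \<ge> 2"
  obtains k where "fam neg V k" "(\<Sum>v\<in>V. weight (deg V v)) - 2 * int (card (comp V ` V))
    + int (card {K \<in> comp V ` V. \<not> good_set K}) \<le> 2 * int k"
proof -
  let ?\<K> = "comp V ` V"
  define c where "c K = (if \<not> good_set K then 1 else 0 :: int)" for K
  have "\<exists>k. fam neg K k \<and> (\<Sum>v\<in>K. weight (deg V v)) - 2 + c K \<le> 2 * int k"
    if K: "K \<in> ?\<K>" for K
  proof -
    obtain x where x: "x \<in> V" "K = comp V x" using K by auto
    have "inertia_bounded K" using x two[OF K] by (intro bounded_connected) (auto simp: connected_comp comp_subset)
    moreover have "(\<Sum>v\<in>K. weight (deg K v)) = (\<Sum>v\<in>K. weight (deg V v))"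
      using x by (intro sum.cong refl) (simp add: nbrs_comp)
    ultimately show ?thesis unfolding inertia_bounded_def c_def by auto
  qed
  then obtain k where k: "\<And>K. K \<in> ?\<K> \<Longrightarrow> fam neg K (k K)"
    "\<And>K. K \<in> ?\<K> \<Longrightarrow> (\<Sum>v\<in>K. weight (deg V v)) - 2 + c K \<le> 2 * int (k K)" by metis
  have "fam neg (\<Union>?\<K>) (\<Sum>K\<in>?\<K>. k K)"
    using finV k(1) pairwise_separated_comps by (intro fam_neg_Union) auto
  then have fam: "fam neg V (\<Sum>K\<in>?\<K>. k K)" by (simp only: Union_comps)
  have "(\<Sum>K\<in>?\<K>. (\<Sum>v\<in>K. weight (deg V v)) - 2 + c K) \<le> (\<Sum>K\<in>?\<K>. 2 * int (k K))"
    using k(2) by (rule sum_mono)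
  moreover have "(\<Sum>K\<in>?\<K>. c K) = int (card {K \<in> ?\<K>. \<not> good_set K})"
    unfolding c_def using finV by (simp add: sum.If_cases Int_def)
  ultimately have "(\<Sum>v\<in>V. weight (deg V v)) - 2 * int (card ?\<K>)
    + int (card {K \<in> ?\<K>. \<not> good_set K}) \<le> 2 * int (\<Sum>K\<in>?\<K>. k K)"
    unfolding sum_over_comps[OF finV, of "\<lambda>v. weight (deg V v)"]
    by (simp add: sum.distrib sum_subtractf sum_distrib_left)
  with fam that show thesis by blast
qed

lemma good_set_deg:
  assumes "good_set K" "v \<in> K"
  shows "deg K v = 2"
  using assms deg_cyc unfolding good_set_def good_def by blast

text \<open>Each cycle contributes half its length plus 1. Against total weight n this leaves at
  most n/2 minus the number of components for the negative index, which matches the lower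
  bound.\<close>

lemma fam_nonneg_good_comps:
  assumes good: "\<And>K. K \<in> comp V ` V \<Longrightarrow> good_set K"
  obtains k where "fam nonneg V k" "2 * k = card V + 2 * card (comp V ` V)"
    "(\<Sum>v\<in>V. weight (deg V v)) = int (card V)"
proof -
  let ?\<K> = "comp V ` V"
  have "fam nonneg K (Suc (card K div 2)) \<and> even (card K)" if K: "K \<in> ?\<K>" for K
  proof -
    obtain vs where vs: "set vs = K" "good vs" using good[OF K] by (auto simp: good_set_def)
    then have "card K = length vs" by (auto simp: good_def cyc_def distinct_card)
    moreover have "K \<subseteq> V" using K comp_subset by blast
    ultimately show ?thesis using fam_nonneg_good_cycle[OF vs(2)] vs by (auto simp: good_def)
  qed
  then have k: "\<And>K. K \<in> ?\<K> \<Longrightarrow> fam nonneg K (Suc (card K div 2))"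
    "\<And>K. K \<in> ?\<K> \<Longrightarrow> even (card K)" by auto
  have "fam nonneg (\<Union>?\<K>) (\<Sum>K\<in>?\<K>. Suc (card K div 2))"
    using finV k(1) pairwise_separated_comps by (intro fam_nonneg_Union) auto
  then have fam: "fam nonneg V (\<Sum>K\<in>?\<K>. Suc (card K div 2))" by (simp only: Union_comps)
  have "2 * (\<Sum>K\<in>?\<K>. Suc (card K div 2)) = (\<Sum>K\<in>?\<K>. card K + 2)"
    unfolding sum_distrib_left using k(2) by (intro sum.cong refl) auto
  also have "\<dots> = (\<Sum>K\<in>?\<K>. card K) + 2 * card ?\<K>" by (subst sum.distrib) simp
  also have "(\<Sum>K\<in>?\<K>. card K) = card V"
    using sum_over_comps[OF finV, of "\<lambda>_. 1 :: nat"] by simp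
  finally have card: "2 * (\<Sum>K\<in>?\<K>. Suc (card K div 2)) = card V + 2 * card ?\<K>" .
  have "weight (deg V v) = 1" if v: "v \<in> V" for v
  proof -
    have "deg (comp V v) v = 2" using v by (intro good_set_deg good) (auto simp: comp_self)
    then show ?thesis using nbrs_comp[OF v comp_self] by (simp add: weight_def)
  qed
  then have "(\<Sum>v\<in>V. weight (deg V v)) = int (card V)" by simp
  with fam card that show thesis by blast
qed

end

lemma real_mod4_sign:
  assumes "even m"
  shows "(-1 :: real) ^ (m div 2) = (if m mod 4 = 0 then 1 else -1)"
proof -
  have "even (m div 2) \<longleftrightarrow> m mod 4 = 0" using assms by presburger
  then show ?thesis by (cases "even (m div 2)") auto
qed

section \<open>The inertia theorem for signed graphs\<close>

sublocale signed_graph \<subseteq> signed_weights "verts \<Gamma>" "adj_entry \<Gamma>"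
proof
  show "finite (verts \<Gamma>)" by (rule finite_verts)
  show "adj_entry \<Gamma> u v = adj_entry \<Gamma> v u" for u v by (simp add: adj_entry_def insert_commute)
  show "adj_entry \<Gamma> v v = 0" for v using edges_simple[of "{v}"] by (auto simp: adj_entry_def)
  show "adj_entry \<Gamma> u v * adj_entry \<Gamma> u v = 1" if "adj_entry \<Gamma> u v \<noteq> 0" for u v
    using that esign_values[of "{u, v}"] by (auto simp: adj_entry_def split: if_splits)
qed

context signed_graph
begin

section \<open>Translation between edge sets and weights\<close>

lemma adj_entry_nonzero: "adj_entry \<Gamma> u v \<noteq> 0 \<longleftrightarrow> {u, v} \<in> edges \<Gamma>"
  using esign_values[of "{u, v}"] by (auto simp: adj_entry_def)

lemma edge_verts: "{u, v} \<in> edges \<Gamma> \<Longrightarrow> u \<in> verts \<Gamma> \<and> v \<in> verts \<Gamma>"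
  using edges_simple by blast

lemma edge_doubleton:
  assumes "e \<in> edges \<Gamma>"
  obtains u v where "e = {u, v}" "u \<noteq> v"
  using edges_simple[OF assms] by (auto simp: card_2_iff)

lemma components_eq: "components \<Gamma> = comp (verts \<Gamma>) ` verts \<Gamma>"
proof -
  have "{(x, y). {x, y} \<in> edges \<Gamma>} = {(x, y). x \<in> verts \<Gamma> \<and> y \<in> verts \<Gamma> \<and> adj_entry \<Gamma> x y \<noteq> 0}"
    using edge_verts by (auto simp: adj_entry_nonzero)
  then have "connected_rel \<Gamma> = {(u, v). u \<in> verts \<Gamma> \<and> v \<in> verts \<Gamma> \<and> (u, v) \<in> conn (verts \<Gamma>)}"
    by (simp add: connected_rel_def conn_def)
  then have "connected_rel \<Gamma> `` {x} = comp (verts \<Gamma>) x" if "x \<in> verts \<Gamma>" for x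
    using comp_subset[OF that] that by (auto simp: comp_def)
  then show ?thesis unfolding components_def quotient_def by auto
qed

lemma degree_eq:
  assumes "v \<in> verts \<Gamma>"
  shows "degree \<Gamma> v = deg (verts \<Gamma>) v"
proof -
  have "{e \<in> edges \<Gamma>. v \<in> e} = (\<lambda>u. {v, u}) ` nbrs (verts \<Gamma>) v"
  proof
    show "{e \<in> edges \<Gamma>. v \<in> e} \<subseteq> (\<lambda>u. {v, u}) ` nbrs (verts \<Gamma>) v"
    proof
      fix e assume e: "e \<in> {e \<in> edges \<Gamma>. v \<in> e}"
      then obtain x y where "e = {x, y}" using edge_doubleton by blast
      with e obtain u where "e = {v, u}" by (auto simp: insert_commute)
      with e show "e \<in> (\<lambda>u. {v, u}) ` nbrs (verts \<Gamma>) v"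
        using edge_verts by (auto simp: nbrs_def adj_entry_nonzero)
    qed
  qed (auto simp: nbrs_def adj_entry_nonzero)
  moreover have "inj_on (\<lambda>u. {v, u}) (nbrs (verts \<Gamma>) v)"
    by (auto simp: inj_on_def doubleton_eq_iff)
  ultimately show ?thesis by (simp add: degree_def card_image)
qed

lemma finite_edges: "finite (edges \<Gamma>)"
  by (rule finite_subset[of _ "Pow (verts \<Gamma>)"]) (use edges_simple finite_verts in auto)

lemma handshake: "(\<Sum>v\<in>verts \<Gamma>. degree \<Gamma> v) = 2 * card (edges \<Gamma>)"
proof -
  have "(\<Sum>v\<in>verts \<Gamma>. degree \<Gamma> v) = (\<Sum>v\<in>verts \<Gamma>. \<Sum>e\<in>edges \<Gamma>. if v \<in> e then 1 else 0)"
    using finite_edges by (simp add: degree_def sum.If_cases Int_def)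
  also have "\<dots> = (\<Sum>e\<in>edges \<Gamma>. \<Sum>v\<in>verts \<Gamma>. if v \<in> e then 1 else 0)" by (rule sum.swap)
  also have "\<dots> = (\<Sum>e\<in>edges \<Gamma>. 2)"
  proof (rule sum.cong[OF refl])
    fix e assume "e \<in> edges \<Gamma>"
    then have "verts \<Gamma> \<inter> e = e" "card e = 2" using edges_simple by auto
    then show "(\<Sum>v\<in>verts \<Gamma>. if v \<in> e then 1 else 0) = (2::nat)"
      using finite_verts by (simp flip: sum.inter_restrict)
  qed
  finally show ?thesis by simp
qed

text \<open>For d \<ge> 1 the weight is 3 - d, less 1 if d = 1; the handshake lemma does the
  rest.\<close>

lemma sum_weight:
  assumes "\<And>v. v \<in> verts \<Gamma> \<Longrightarrow> degree \<Gamma> v \<ge> 1"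
  shows "(\<Sum>v\<in>verts \<Gamma>. weight (deg (verts \<Gamma>) v))
    = 3 * int (card (verts \<Gamma>)) - 2 * int (card (edges \<Gamma>)) - int (num_pendant \<Gamma>)"
proof -
  have "(\<Sum>v\<in>verts \<Gamma>. weight (deg (verts \<Gamma>) v))
      = (\<Sum>v\<in>verts \<Gamma>. 3 - int (degree \<Gamma> v) - (if degree \<Gamma> v = 1 then 1 else 0))"
  proof (rule sum.cong[OF refl])
    fix v assume "v \<in> verts \<Gamma>"
    then show "weight (deg (verts \<Gamma>) v) = 3 - int (degree \<Gamma> v) - (if degree \<Gamma> v = 1 then 1 else 0)"
      using assms[of v] by (auto simp: weight_def degree_eq)
  qed
  also have "\<dots> = 3 * int (card (verts \<Gamma>)) - int (\<Sum>v\<in>verts \<Gamma>. degree \<Gamma> v) - int (num_pendant \<Gamma>)"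
    using finite_verts by (simp add: sum_subtractf sum.If_cases Int_def num_pendant_def)
  finally show ?thesis by (simp add: handshake)
qed

section \<open>Inertia bounds for the adjacency matrix\<close>

lemma adj_mat_symmetric:
  "adj_mat \<Gamma> \<in> carrier_mat (card (verts \<Gamma>)) (card (verts \<Gamma>))" "transpose_mat (adj_mat \<Gamma>) = adj_mat \<Gamma>"
  by (auto simp: adj_mat_def graph_order_def sym)

lemma vertex_list_bij: "bij_betw (\<lambda>i. vertex_list \<Gamma> ! i) {..<card (verts \<Gamma>)} (verts \<Gamma>)"
  using vertex_list[OF finite_verts] distinct_card[of "vertex_list \<Gamma>"]
  by (intro bij_betw_nth) auto

lemma quad_adj_mat:
  "quad (card (verts \<Gamma>)) (adj_mat \<Gamma>) (\<lambda>i. f (vertex_list \<Gamma> ! i)) = bil f f"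
proof -
  let ?l = "\<lambda>i. vertex_list \<Gamma> ! i"
  have "bil f f = (\<Sum>u\<in>verts \<Gamma>. \<Sum>v\<in>verts \<Gamma>. adj_entry \<Gamma> u v * f u * f v)"
    by (simp add: bil_def act_def sum_distrib_left mult_ac)
  also have "\<dots> = (\<Sum>i<card (verts \<Gamma>). \<Sum>j<card (verts \<Gamma>). adj_entry \<Gamma> (?l i) (?l j) * f (?l i) * f (?l j))"
    by (simp only: sum.reindex_bij_betw[OF vertex_list_bij, symmetric])
  finally show ?thesis by (simp add: quad_def adj_mat_def graph_order_def)
qed

lemma neg_inertia_eq: "neg_inertia \<Gamma> = neg_eigenvalue_count (adj_mat \<Gamma>)"
  by (simp add: neg_inertia_def neg_eigenvalue_count_def)

lemma neg_inertia_ge: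
  assumes "fam neg (verts \<Gamma>) k"
  shows "k \<le> neg_inertia \<Gamma>"
proof -
  obtain F where F: "\<forall>c. (\<exists>i<k. c i \<noteq> 0) \<longrightarrow> neg (\<lambda>v. \<Sum>i<k. c i * F i v)"
    using assms unfolding fam_def by blast
  show ?thesis unfolding neg_inertia_eq
  proof (rule neg_definite_family_le[OF adj_mat_symmetric])
    fix c :: "nat \<Rightarrow> real" assume "\<exists>l<k. c l \<noteq> 0"
    with F have "neg (\<lambda>v. \<Sum>i<k. c i * F i v)" by blast
    then show "quad (card (verts \<Gamma>)) (adj_mat \<Gamma>) (\<lambda>i. \<Sum>l<k. c l * F l (vertex_list \<Gamma> ! i)) < 0"
      unfolding neg_def by (subst quad_adj_mat)
  qed
qed

lemma neg_inertia_le: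
  assumes "fam nonneg (verts \<Gamma>) k"
  shows "neg_inertia \<Gamma> + k \<le> card (verts \<Gamma>)"
proof -
  obtain F where F: "\<forall>c. (\<exists>i<k. c i \<noteq> 0) \<longrightarrow> nonneg (\<lambda>v. \<Sum>i<k. c i * F i v)"
    using assms unfolding fam_def by blast
  show ?thesis unfolding neg_inertia_eq
  proof (rule nonneg_family_le[OF adj_mat_symmetric])
    fix c :: "nat \<Rightarrow> real" assume "\<exists>l<k. c l \<noteq> 0"
    with F have "nonneg (\<lambda>v. \<Sum>i<k. c i * F i v)" by blast
    then obtain v where v: "v \<in> verts \<Gamma>" "(\<Sum>i<k. c i * F i v) \<noteq> 0" by (auto simp: nonneg_def)
    have "verts \<Gamma> = (\<lambda>i. vertex_list \<Gamma> ! i) ` {..<card (verts \<Gamma>)}"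
      using vertex_list_bij by (simp add: bij_betw_def)
    with v(1) obtain i where "i < card (verts \<Gamma>)" "v = vertex_list \<Gamma> ! i" by blast
    with v(2) show "\<exists>i<card (verts \<Gamma>). (\<Sum>l<k. c l * F l (vertex_list \<Gamma> ! i)) \<noteq> 0" by blast
  next
    fix c :: "nat \<Rightarrow> real"
    \<comment> \<open>The bound needed concerns all combinations, whereas \<open>fam\<close> speaks
      only of nontrivial ones.\<close>
    have "bil (\<lambda>v. \<Sum>i<k. c i * F i v) (\<lambda>v. \<Sum>i<k. c i * F i v) \<ge> 0"
    proof (cases "\<exists>l<k. c l \<noteq> 0")
      case True
      with F show ?thesis by (simp add: nonneg_def)
    qed (simp add: bil_def)
    then show "quad (card (verts \<Gamma>)) (adj_mat \<Gamma>) (\<lambda>i. \<Sum>l<k. c l * F l (vertex_list \<Gamma> ! i)) \<ge> 0"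
      by (subst quad_adj_mat)
  qed
qed

text \<open>After doubling, the equation is one between integers. The lower bound exceeds its
  right-hand side by the number of components that are not good, and for good components an
  isotropic family gives the reverse inequality.\<close>

theorem neg_inertia_extremal_iff:
  assumes two: "\<forall>K\<in>components \<Gamma>. card K \<ge> 2"
  shows "real (neg_inertia \<Gamma>) = (real (card (verts \<Gamma>)) - real (num_pendant \<Gamma>)) / 2
      - real_of_int (cyclomatic_number \<Gamma>) \<longleftrightarrow> (\<forall>K\<in>components \<Gamma>. good_set K)"
    (is "?eq \<longleftrightarrow> ?good")
proof -
  have deg1: "degree \<Gamma> v \<ge> 1" if v: "v \<in> verts \<Gamma>" for v
  proof -
    have "card (comp (verts \<Gamma>) v) \<ge> 2" using two v by (simp add: components_eq)
    then have "nbrs (comp (verts \<Gamma>) v) v \<noteq> {}"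
      by (intro nbrs_nonempty connected_comp v comp_self)
    then have "nbrs (verts \<Gamma>) v \<noteq> {}" using nbrs_comp[OF v comp_self] by simp
    then show ?thesis using finite_nbrs[of "verts \<Gamma>" v] v by (simp add: degree_eq Suc_le_eq card_gt_0_iff)
  qed
  define W where "W = 3 * int (card (verts \<Gamma>)) - 2 * int (card (edges \<Gamma>)) - int (num_pendant \<Gamma>)"
  have W: "(\<Sum>v\<in>verts \<Gamma>. weight (deg (verts \<Gamma>) v)) = W"
    unfolding W_def by (rule sum_weight[OF deg1])
  have eq: "?eq \<longleftrightarrow> 2 * int (neg_inertia \<Gamma>) = W - 2 * int (card (components \<Gamma>))"
  proof -
    have "?eq \<longleftrightarrow> 2 * real (neg_inertia \<Gamma>) = real_of_int (W - 2 * int (card (components \<Gamma>)))"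
      by (simp add: cyclomatic_number_def W_def field_simps)
    also have "2 * real (neg_inertia \<Gamma>) = real_of_int (2 * int (neg_inertia \<Gamma>))" by simp
    finally show ?thesis by (simp only: of_int_eq_iff)
  qed
  let ?\<K> = "comp (verts \<Gamma>) ` verts \<Gamma>"
  obtain k where k: "fam neg (verts \<Gamma>) k"
    "(\<Sum>v\<in>verts \<Gamma>. weight (deg (verts \<Gamma>) v)) - 2 * int (card ?\<K>)
      + int (card {K \<in> ?\<K>. \<not> good_set K}) \<le> 2 * int k"
  proof (rule fam_neg_lower_bound)
    show "card K \<ge> 2" if "K \<in> ?\<K>" for K using that two unfolding components_eq by blast
  qed (rule that)
  have ge: "W - 2 * int (card (components \<Gamma>)) + int (card {K \<in> components \<Gamma>. \<not> good_set K}) \<le> 2 * int (neg_inertia \<Gamma>)"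
    using k(2) neg_inertia_ge[OF k(1)] unfolding W components_eq by linarith
  show ?thesis unfolding eq
  proof
    assume "2 * int (neg_inertia \<Gamma>) = W - 2 * int (card (components \<Gamma>))"
    with ge have "card {K \<in> components \<Gamma>. \<not> good_set K} = 0" by linarith
    moreover have "finite (components \<Gamma>)" using finite_verts by (simp add: components_eq)
    ultimately show ?good by auto
  next
    assume ?good
    then have "good_set K" if "K \<in> ?\<K>" for K using that unfolding components_eq by blast
    then obtain l where l: "fam nonneg (verts \<Gamma>) l" "2 * l = card (verts \<Gamma>) + 2 * card ?\<K>"
      "(\<Sum>v\<in>verts \<Gamma>. weight (deg (verts \<Gamma>) v)) = int (card (verts \<Gamma>))"
      by (rule fam_nonneg_good_comps) (assumption | rule that)+
    have "2 * int (neg_inertia \<Gamma>) \<le> W - 2 * int (card (components \<Gamma>))"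
      using neg_inertia_le[OF l(1)] l(2,3) unfolding W components_eq by linarith
    with ge show "2 * int (neg_inertia \<Gamma>) = W - 2 * int (card (components \<Gamma>))" by linarith
  qed
qed

section \<open>Good components and disjoint unions of signed cycles\<close>

lemma cycle_sign_eq:
  assumes c: "cyc vs" and E: "edges C = {{vs ! i, vs ! (Suc i mod length vs)} | i. i < length vs}"
    and sub: "edges C \<subseteq> edges \<Gamma>" and sgn: "\<And>e. e \<in> edges C \<Longrightarrow> esign \<Gamma> e = esign C e"
  shows "cycle_sign C = (\<Prod>i<length vs. wt vs i)"
proof -
  define m where "m = length vs"
  define e where "e i = {vs ! i, vs ! (Suc i mod m)}" for i
  have m: "m \<ge> 3" "distinct vs" using c by (auto simp: cyc_def m_def)
  have E': "edges C = e ` {..<m}" unfolding E by (auto simp: e_def m_def)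
  \<comment> \<open>The cycle sign is a product over a set of edges. Two indices with the same edge
    would be successors of each other, which length at least 3 excludes.\<close>
  have "inj_on e {..<m}"
  proof (rule inj_onI)
    fix i j assume ij: "i \<in> {..<m}" "j \<in> {..<m}" "e i = e j"
    have "Suc i mod m < m" "Suc j mod m < m" using m by auto
    with ij have "i = j \<or> i = Suc j mod m \<and> j = Suc i mod m"
      using m by (auto simp: e_def doubleton_eq_iff nth_eq_iff_index_eq m_def)
    then show "i = j" using ij m by (auto simp: Suc_mod_eq split: if_splits)
  qed
  then have "cycle_sign C = (\<Prod>i<m. esign C (e i))"
    unfolding cycle_sign_def E' by (simp add: prod.reindex)
  also have "\<dots> = (\<Prod>i<m. wt vs i)"
  proof (rule prod.cong[OF refl])
    fix i assume "i \<in> {..<m}"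
    then have "e i \<in> edges C" by (simp add: E')
    then show "esign C (e i) = wt vs i"
      using sub sgn[of "e i"] by (auto simp: wt_def adj_entry_def e_def m_def)
  qed
  finally show ?thesis by (simp add: m_def)
qed

lemma prod_wt_pm1:
  assumes "cyc vs"
  shows "(\<Prod>i<length vs. wt vs i) = 1 \<or> (\<Prod>i<length vs. wt vs i) = -1"
proof -
  have "(\<Prod>i<length vs. wt vs i) * (\<Prod>i<length vs. wt vs i) = (\<Prod>i<length vs. wt vs i * wt vs i)"
    by (simp add: prod.distrib)
  also have "\<dots> = 1" using wt_square[OF assms] by (intro prod.neutral) auto
  finally show ?thesis by (simp add: square_eq_1_iff)
qed

text \<open>The subgraph induced on \<open>K\<close> has exactly the cycle edges, because
  \<open>cyc\<close> excludes chords.\<close>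

lemma good_set_signed_cycle:
  assumes good: "good_set K" and K: "K \<subseteq> verts \<Gamma>"
  defines "C \<equiv> \<lparr>verts = K, edges = {e \<in> edges \<Gamma>. e \<subseteq> K}, esign = esign \<Gamma>\<rparr>"
  shows "is_signed_cycle (card K) C" "balanced_cycle C \<Longrightarrow> card K mod 4 = 0"
    "unbalanced_cycle C \<Longrightarrow> card K mod 4 = 2"
proof -
  obtain vs where vs: "set vs = K" "good vs" using good by (auto simp: good_set_def)
  then have c: "cyc vs" and ev: "even (length vs)"
    and pr: "(\<Prod>i<length vs. wt vs i) = (-1) ^ (length vs div 2)" by (auto simp: good_def)
  have d: "distinct vs" and m3: "length vs \<ge> 3" using c by (auto simp: cyc_def)
  have cK: "card K = length vs" using vs d by (auto simp: distinct_card)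
  have sg: "signed_graph C"
    using finite_subset[OF K finite_verts] edges_simple esign_values by unfold_locales (auto simp: C_def)
  have E: "edges C = {{vs ! i, vs ! (Suc i mod length vs)} | i. i < length vs}" (is "_ = ?E")
  proof
    show "edges C \<subseteq> ?E"
    proof
      fix e assume e: "e \<in> edges C"
      then have "e \<in> edges \<Gamma>" by (simp add: C_def)
      then obtain u v where uv: "e = {u, v}" by (rule edge_doubleton)
      then obtain i j where ij: "i < length vs" "j < length vs" "u = vs ! i" "v = vs ! j"
        using e vs(1) by (auto simp: C_def in_set_conv_nth)
      then have "adj_entry \<Gamma> (vs ! i) (vs ! j) \<noteq> 0" using e uv by (auto simp: C_def adj_entry_nonzero)
      then have "j = Suc i mod length vs \<or> i = Suc j mod length vs" using c ij unfolding cyc_def by blast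
      then show "e \<in> ?E" using ij uv by (auto simp: insert_commute)
    qed
    show "?E \<subseteq> edges C"
    proof
      fix e assume "e \<in> ?E"
      then obtain i where i: "i < length vs" "e = {vs ! i, vs ! (Suc i mod length vs)}" by blast
      have "Suc i mod length vs < length vs" using m3 by (intro mod_less_divisor) auto
      then show "e \<in> edges C" using cyc_step[OF c i(1)] i vs(1) by (auto simp: C_def adj_entry_nonzero)
    qed
  qed
  show "is_signed_cycle (card K) C"
    unfolding is_signed_cycle_def using sg m3 E d vs(1) by (auto simp: cK C_def intro!: exI[of _ vs])
  have "cycle_sign C = (\<Prod>i<length vs. wt vs i)"
    by (rule cycle_sign_eq[OF c E]) (auto simp: C_def)
  then have "cycle_sign C = (if card K mod 4 = 0 then 1 else -1)"
    using real_mod4_sign[OF ev] pr by (simp add: cK)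
  moreover have "card K mod 4 = 0 \<or> card K mod 4 = 2" using ev unfolding cK by presburger
  ultimately show "balanced_cycle C \<Longrightarrow> card K mod 4 = 0" "unbalanced_cycle C \<Longrightarrow> card K mod 4 = 2"
    by (auto simp: balanced_cycle_def unbalanced_cycle_def split: if_splits)
qed

text \<open>The vertex set of the cycle through \<open>x\<close> is connected and closed under
  adjacency in the whole graph, so it is the component of \<open>x\<close>.\<close>

lemma disjoint_cycles_good:
  assumes U: "is_disjoint_union \<Gamma> t C" and cycle: "\<forall>i<t. is_signed_cycle (m i) (C i)"
    and mod4: "\<forall>i<t. (balanced_cycle (C i) \<longrightarrow> m i mod 4 = 0) \<and> (unbalanced_cycle (C i) \<longrightarrow> m i mod 4 = 2)"
    and K: "K \<in> components \<Gamma>"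
  shows "good_set K"
proof -
  obtain x where x: "x \<in> verts \<Gamma>" "K = comp (verts \<Gamma>) x" using K by (auto simp: components_eq)
  from U have disj: "\<And>i j. i < t \<Longrightarrow> j < t \<Longrightarrow> i \<noteq> j \<Longrightarrow> verts (C i) \<inter> verts (C j) = {}"
    and vU: "verts \<Gamma> = (\<Union>i<t. verts (C i))" and eU: "edges \<Gamma> = (\<Union>i<t. edges (C i))"
    and sgn: "\<And>i e. i < t \<Longrightarrow> e \<in> edges (C i) \<Longrightarrow> esign \<Gamma> e = esign (C i) e"
    by (auto simp: is_disjoint_union_def disjoint_family_on_def)
  obtain i where i: "i < t" "x \<in> verts (C i)" using x(1) vU by auto
  have sgC: "signed_graph (C j)" if "j < t" for j using cycle that by (auto simp: is_signed_cycle_def)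
  \<comment> \<open>An edge of another cycle has both ends there, so disjointness keeps it away from
    \<open>u\<close>.\<close>
  have CE: "{u, v} \<in> edges (C i)" if uv: "u \<in> verts (C i)" "{u, v} \<in> edges \<Gamma>" for u v
  proof -
    obtain j where j: "j < t" "{u, v} \<in> edges (C j)" using uv(2) eU by auto
    then have "u \<in> verts (C j)" using signed_graph.edges_simple[OF sgC] by blast
    then have "j = i" using disj[OF j(1) i(1)] uv(1) by blast
    then show ?thesis using j by simp
  qed
  have "is_signed_cycle (m i) (C i)" using cycle i(1) by blast
  then obtain vs where vs: "length vs = m i" "distinct vs" "verts (C i) = set vs"
    "edges (C i) = {{vs ! j, vs ! (Suc j mod m i)} | j. j < m i}" and m3: "m i \<ge> 3"
    unfolding is_signed_cycle_def by (elim exE conjE) (rule that)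
  note vs = vs(1-3) vs(4)[folded vs(1)] and m3 = m3[folded vs(1)]
  have c: "cyc vs" unfolding cyc_def
  proof (intro conjI allI impI)
    fix j l assume jl: "j < length vs" "l < length vs"
    have md: "Suc k mod length vs < length vs" for k using m3 by (intro mod_less_divisor) auto
    have "adj_entry \<Gamma> (vs ! j) (vs ! l) \<noteq> 0 \<longleftrightarrow> {vs ! j, vs ! l} \<in> edges (C i)"
      using CE[of "vs ! j" "vs ! l"] jl vs(3) eU i(1) by (auto simp: adj_entry_nonzero)
    also have "\<dots> \<longleftrightarrow> (\<exists>k<length vs. {vs ! j, vs ! l} = {vs ! k, vs ! (Suc k mod length vs)})"
      unfolding vs(4) by blast
    also have "\<dots> \<longleftrightarrow> (\<exists>k<length vs. j = k \<and> l = Suc k mod length vs \<or> j = Suc k mod length vs \<and> l = k)"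
      using vs(2) jl md by (auto simp: doubleton_eq_iff nth_eq_iff_index_eq)
    also have "\<dots> \<longleftrightarrow> l = Suc j mod length vs \<or> j = Suc l mod length vs" using jl by auto
    finally show "(adj_entry \<Gamma> (vs ! j) (vs ! l) \<noteq> 0) = (l = Suc j mod length vs \<or> j = Suc l mod length vs)" .
  qed (use vs m3 in auto)
  have "cycle_sign (C i) = (\<Prod>j<length vs. wt vs j)"
    by (rule cycle_sign_eq[OF c vs(4)]) (use eU i(1) sgn in auto)
  \<comment> \<open>A cycle is either balanced or unbalanced, so one of the two congruences applies;
    both make the length even.\<close>
  moreover from prod_wt_pm1[OF c] have "(\<Prod>j<length vs. wt vs j) = 1 \<and> length vs mod 4 = 0 \<or>
      (\<Prod>j<length vs. wt vs j) = -1 \<and> length vs mod 4 = 2"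
    using mod4 i(1) calculation vs(1) by (auto simp: balanced_cycle_def unbalanced_cycle_def)
  moreover from this have ev: "even (length vs)"
    by (elim disjE conjE) presburger+
  ultimately have "good vs" using c real_mod4_sign[OF ev] by (auto simp: good_def)
  moreover have "comp (verts \<Gamma>) x = set vs"
  proof (rule comp_eq_closed[OF connected_cyc[OF c]])
    show "set vs \<subseteq> verts \<Gamma>" "x \<in> set vs" using vU vs(3) i by auto
    fix v assume v: "v \<in> set vs"
    show "nbrs (verts \<Gamma>) v \<subseteq> set vs"
    proof
      fix u assume "u \<in> nbrs (verts \<Gamma>) v"
      then have "{v, u} \<in> edges (C i)" using CE v vs(3) by (auto simp: nbrs_def adj_entry_nonzero)
      then show "u \<in> set vs" using signed_graph.edges_simple[OF sgC[OF i(1)]] vs(3) by blast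
    qed
  qed
  ultimately show ?thesis using x(2) unfolding good_set_def by blast
qed

lemma good_disjoint_cycles:
  assumes good: "\<forall>K\<in>components \<Gamma>. good_set K"
  shows "\<exists>t m C. is_disjoint_union \<Gamma> t C \<and> (\<forall>i<t. is_signed_cycle (m i) (C i)) \<and>
    (\<Sum>i<t. m i) = card (verts \<Gamma>) \<and>
    (\<forall>i<t. (balanced_cycle (C i) \<longrightarrow> m i mod 4 = 0) \<and> (unbalanced_cycle (C i) \<longrightarrow> m i mod 4 = 2))"
proof -
  have fin: "finite (components \<Gamma>)" using finite_verts by (simp add: components_eq)
  define t where "t = card (components \<Gamma>)"
  obtain h where h: "bij_betw h {..<t} (components \<Gamma>)"
    using ex_bij_betw_nat_finite[OF fin] by (auto simp: atLeast0LessThan t_def)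
  have hK: "h i \<in> components \<Gamma>" if "i < t" for i using h that by (auto simp: bij_betw_def)
  have sub: "h i \<subseteq> verts \<Gamma>" if "i < t" for i using hK[OF that] comp_subset by (auto simp: components_eq)
  have sep: "separated (h i) (h j)" if "i < t" "j < t" "i \<noteq> j" for i j
  proof -
    have "h i \<noteq> h j" using h that by (auto simp: bij_betw_def inj_on_def)
    moreover have "pairwise separated (components \<Gamma>)"
      unfolding components_eq by (rule pairwise_separated_comps)
    ultimately show ?thesis using hK that by (auto simp: pairwise_def)
  qed
  have img: "h ` {..<t} = components \<Gamma>" using h by (simp add: bij_betw_def)
  then have cover: "(\<Union>i<t. h i) = verts \<Gamma>" using Union_comps[of "verts \<Gamma>"] by (simp add: components_eq)
  define C where "C i = \<lparr>verts = h i, edges = {e \<in> edges \<Gamma>. e \<subseteq> h i}, esign = esign \<Gamma>\<rparr>" for i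
  have "edges \<Gamma> = (\<Union>i<t. edges (C i))"
  proof
    show "edges \<Gamma> \<subseteq> (\<Union>i<t. edges (C i))"
    proof
      fix e assume e: "e \<in> edges \<Gamma>"
      then obtain u v where uv: "e = {u, v}" using edge_doubleton by blast
      have V: "u \<in> verts \<Gamma>" "v \<in> verts \<Gamma>" using e uv edge_verts by auto
      obtain i where i: "i < t" "u \<in> h i" using V(1) cover by auto
      obtain j where j: "j < t" "v \<in> h j" using V(2) cover by auto
      have "adj_entry \<Gamma> u v \<noteq> 0" using e uv by (simp add: adj_entry_nonzero)
      \<comment> \<open>No edge joins separated components, so both ends lie in the same
        one.\<close>
      then have "i = j" using sep[OF i(1) j(1)] i j unfolding separated_def by blast
      then have "e \<in> edges (C i)" using i j e uv by (simp add: C_def)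
      then show "e \<in> (\<Union>i<t. edges (C i))" using i by blast
    qed
  qed (auto simp: C_def)
  moreover have "disjoint_family_on (\<lambda>i. verts (C i)) {..<t}"
    using sep unfolding disjoint_family_on_def separated_def by (auto simp: C_def)
  ultimately have "is_disjoint_union \<Gamma> t C"
    using cover by (simp add: is_disjoint_union_def C_def)
  moreover have "is_signed_cycle (card (h i)) (C i) \<and> (balanced_cycle (C i) \<longrightarrow> card (h i) mod 4 = 0) \<and>
      (unbalanced_cycle (C i) \<longrightarrow> card (h i) mod 4 = 2)" if "i < t" for i
    using good_set_signed_cycle[of "h i"] good hK[OF that] sub[OF that] by (auto simp: C_def)
  moreover have "(\<Sum>i<t. card (h i)) = card (verts \<Gamma>)"
  proof -
    have "(\<Sum>i<t. card (h i)) = (\<Sum>K\<in>components \<Gamma>. card K)" by (rule sum.reindex_bij_betw[OF h])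
    also have "\<dots> = card (verts \<Gamma>)"
      using sum_over_comps[OF finite_verts, of "\<lambda>_. 1 :: nat"] by (simp add: components_eq)
    finally show ?thesis .
  qed
  ultimately show ?thesis by (intro exI[of _ t] exI[of _ "\<lambda>i. card (h i)"] exI[of _ C]) auto
qed

end

theorem theorem4p2:
  fixes \<Gamma> :: "'a sgraph" and n :: nat
  assumes "signed_graph \<Gamma>"
    and "graph_order \<Gamma> = n"
    and "\<forall>K \<in> components \<Gamma>. card K \<ge> 2"
  shows "real (neg_inertia \<Gamma>)
           = (real n - real (num_pendant \<Gamma>)) / 2 - real_of_int (cyclomatic_number \<Gamma>)
     \<longleftrightarrow>
     (\<exists>(t::nat) (m :: nat \<Rightarrow> nat) (C :: nat \<Rightarrow> 'a sgraph).
        is_disjoint_union \<Gamma> t C \<and>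
        (\<forall>i<t. is_signed_cycle (m i) (C i)) \<and>
        (\<Sum>i<t. m i) = n \<and>
        (\<forall>i<t. (balanced_cycle (C i) \<longrightarrow> m i mod 4 = 0) \<and>
               (unbalanced_cycle (C i) \<longrightarrow> m i mod 4 = 2)))"
proof -
  interpret signed_graph \<Gamma> by fact
  have n: "n = card (verts \<Gamma>)" using assms(2) by (simp add: graph_order_def)
  show ?thesis
    unfolding n neg_inertia_extremal_iff[OF assms(3)]
    using good_disjoint_cycles disjoint_cycles_good by blast
qed

end
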